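(* Let $\mathcal{S}\subset\mathbb{Z}$ with $\max\mathcal{S}=1$. Let $\ell\le 0\le r$ and let $(n_i)_{\ell\le i\le r}$ be a sequence of positive integers. If $\min\mathcal{S}=-1$ or $\ell=0$, the number of $\mathcal{S}$-embedded Cayley trees having vertical profile $(n_\ell,\ldots,n_{-1};n_0,n_1,\ldots,n_r)$ is $$\frac{n_0}{n_\ell n_r}\,\frac{n!}{\prod_{i=\ell}^r (n_i-1)!}\prod_{i=\ell}^r\Big(\sum_{s\in\mathcal{S}}n_{i-s}\Big)^{n_i-1},$$ where $n=\sum_i n_i$ is the number of vertices and $n_i=0$ if $i<\ell$ or $i>r$.
   Context: A rooted Cayley tree of size $n$ is a tree on the vertex set $\{1,\ldots,n\}$ with a distinguished root vertex. For $\mathcal{S}\subset\mathbb{Z}$, an $\mathcal{S}$-embedded Cayley tree is a rooted Cayley tree together with an assignment of an abscissa $a(v)\in\mathbb{Z}$ to each vertex $v$ such that the root has abscissa $0$ and $a(v')-a(v)\in\mathcal{S}$ whenever $v'$ is a child of $v$. The vertical profile is $(n_\ell,\ldots,n_{-1};n_0,\ldots,n_r)$, where $n_i$ is the number of vertices at abscissa $i$ and $\ell$ (resp. $r$) is the smallest (resp. largest) abscissa occurring. *)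

theory Defs
  imports Complex_Main "HOL-Library.FuncSet"
begin

definition simple_graph :: "'v set \<Rightarrow> 'v set set \<Rightarrow> bool" where
  "simple_graph V E \<longleftrightarrow> (\<forall>e\<in>E. \<exists>u\<in>V. \<exists>v\<in>V. u \<noteq> v \<and> e = {u, v})"

definition walk :: "'v set \<Rightarrow> 'v set set \<Rightarrow> 'v list \<Rightarrow> bool" where
  "walk V E p \<longleftrightarrow> p \<noteq> [] \<and> set p \<subseteq> V \<and> successively (\<lambda>u v. {u, v} \<in> E) p"

definition simple_path :: "'v set \<Rightarrow> 'v set set \<Rightarrow> 'v list \<Rightarrow> bool" where
  "simple_path V E p \<longleftrightarrow> walk V E p \<and> distinct p"

text \<open>A cycle is listed without repeating its starting vertex at the end.\<close>

definition graph_cycle :: "'v set \<Rightarrow> 'v set set \<Rightarrow> 'v list \<Rightarrow> bool" where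
  "graph_cycle V E p \<longleftrightarrow> simple_path V E p \<and> 3 \<le> length p \<and> {last p, hd p} \<in> E"

definition connected_graph :: "'v set \<Rightarrow> 'v set set \<Rightarrow> bool" where
  "connected_graph V E \<longleftrightarrow> V \<noteq> {} \<and> (\<forall>u\<in>V. \<forall>v\<in>V. \<exists>p. walk V E p \<and> hd p = u \<and> last p = v)"

definition tree_graph :: "'v set \<Rightarrow> 'v set set \<Rightarrow> bool" where
  "tree_graph V E \<longleftrightarrow> simple_graph V E \<and> connected_graph V E \<and> (\<nexists>p. graph_cycle V E p)"

definition rooted_cayley_tree :: "nat \<Rightarrow> nat set set \<Rightarrow> nat \<Rightarrow> bool" where
  "rooted_cayley_tree N E \<rho> \<longleftrightarrow> tree_graph {1..N} E \<and> \<rho> \<in> {1..N}"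

text \<open>\<open>child_of V E \<rho> v v'\<close>: the vertex \<open>v'\<close> is a child of \<open>v\<close> in the tree rooted at \<open>\<rho>\<close>,
  i.e. \<open>v\<close> is the last vertex before \<open>v'\<close> on the path from \<open>\<rho>\<close> to \<open>v'\<close>.\<close>

definition child_of :: "'v set \<Rightarrow> 'v set set \<Rightarrow> 'v \<Rightarrow> 'v \<Rightarrow> 'v \<Rightarrow> bool" where
  "child_of V E \<rho> v v' \<longleftrightarrow> (\<exists>p. simple_path V E (p @ [v, v']) \<and> hd (p @ [v, v']) = \<rho>)"

text \<open>Extensionality of \<open>a\<close> makes each abscissa assignment on \<open>{1..N}\<close> correspond to exactly one
  function, so that cardinalities count trees correctly.\<close>

definition embedded_cayley_tree ::
  "int set \<Rightarrow> nat \<Rightarrow> nat set set \<Rightarrow> nat \<Rightarrow> (nat \<Rightarrow> int) \<Rightarrow> bool" where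
  "embedded_cayley_tree S N E \<rho> a \<longleftrightarrow>
     rooted_cayley_tree N E \<rho> \<and> a \<in> extensional {1..N} \<and> a \<rho> = 0 \<and>
     (\<forall>v\<in>{1..N}. \<forall>v'\<in>{1..N}. child_of {1..N} E \<rho> v v' \<longrightarrow> a v' - a v \<in> S)"

definition has_vertical_profile ::
  "nat \<Rightarrow> (nat \<Rightarrow> int) \<Rightarrow> int \<Rightarrow> int \<Rightarrow> (int \<Rightarrow> nat) \<Rightarrow> bool" where
  "has_vertical_profile N a l r n \<longleftrightarrow>
     l = Min (a ` {1..N}) \<and> r = Max (a ` {1..N}) \<and>
     (\<forall>i\<in>{l..r}. card {v\<in>{1..N}. a v = i} = n i)"

definition embedded_cayley_trees_with_profile ::
  "int set \<Rightarrow> int \<Rightarrow> int \<Rightarrow> (int \<Rightarrow> nat) \<Rightarrow> (nat \<times> nat set set \<times> nat \<times> (nat \<Rightarrow> int)) set" where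
  "embedded_cayley_trees_with_profile S l r n =
     {(N, E, \<rho>, a). embedded_cayley_tree S N E \<rho> a \<and> has_vertical_profile N a l r n}"

text \<open>The sum of \<open>n (i - s)\<close> over \<open>s \<in> S\<close>. As \<open>S\<close> may be infinite, the sum is restricted to its
  nonzero terms; there are finitely many of them when \<open>n\<close> has finite support.\<close>

definition step_sum :: "int set \<Rightarrow> (int \<Rightarrow> nat) \<Rightarrow> int \<Rightarrow> nat" where
  "step_sum S n i = (\<Sum>s \<in> {s\<in>S. n (i - s) \<noteq> 0}. n (i - s))"

end

theory Submission
  imports Defs "HOL-Combinatorics.Permutations"
begin

text \<open>A tree is encoded by its parent map, so for fixed abscissas we count acyclic maps \<open>h\<close> that send
  exactly one vertex of level \<open>0\<close> to an exit and respect the steps. Precomposing \<open>h\<close> with a permutation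
  that preserves levels keeps all constraints except acyclicity. Removing vertices without preimage
  one at a time shows that, for fixed \<open>h\<close>, the number of such permutations \<open>\<sigma>\<close> with \<open>h \<circ> \<sigma>\<close>
  acyclic is the product over the levels \<open>i\<close> of \<open>(n\<^sub>i - 1)! c\<^sub>i\<close>, where \<open>c\<^sub>i\<close> is the
  number of vertices on level \<open>i\<close> whose image is one level closer to \<open>0\<close> (an exit if \<open>i = 0\<close>).
  Summing over all \<open>h\<close> amounts to choosing one such vertex per level and all other images freely.
  A multinomial coefficient counts the assignments of abscissas.\<close>

section \<open>Acyclic maps up to level-preserving permutations\<close>

text \<open>Composing on the right keeps the image of \<open>h\<close>, so a vertex without preimage
  under \<open>h\<close> has none under any \<open>h \<circ> \<sigma>\<close>; this is why leaves
  can be removed for all \<open>\<sigma>\<close> at once. That only the numbers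
  \<open>c\<^sub>i\<close> matter comes from the bounds on the steps: a step towards
  \<open>0\<close> has length one, so no orbit on its way to an exit can skip a level. On positive
  levels this is \<open>max S = 1\<close>, on negative ones \<open>min S = -1\<close>; with
  \<open>l = 0\<close> there are none. In the sum over \<open>h\<close>, the chosen vertex of level
  \<open>i\<close> has \<open>n (i - sgn i)\<close> possible images (one if \<open>i = 0\<close>)
  and each other vertex has \<open>step_sum S n i\<close>, whence the exponent
  \<open>n i - 1\<close>. The \<open>n i\<close> choices turn \<open>(n i - 1)!\<close> into
  \<open>(n i)!\<close>, the number of permutations of the level, and both cancel. The product of
  \<open>n (i - sgn i)\<close> over \<open>i \<noteq> 0\<close> telescopes to
  \<open>n 0 / (n l * n r)\<close> times the product of all \<open>n i\<close>, which lowers the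
  factorials of the multinomial coefficient to \<open>(n i - 1)!\<close>.\<close>

text \<open>Points outside \<open>V\<close> act as exits: for finite \<open>V\<close> the condition says that every \<open>f\<close>-orbit
  leaves \<open>V\<close>.\<close>

definition acyclic_map :: "'v set \<Rightarrow> ('v \<Rightarrow> 'v) \<Rightarrow> bool" where
  "acyclic_map V f \<longleftrightarrow> (\<forall>U\<subseteq>V. f ` U \<subseteq> U \<longrightarrow> U = {})"

lemma acyclic_mapD: "acyclic_map V f \<Longrightarrow> U \<subseteq> V \<Longrightarrow> (\<And>u. u \<in> U \<Longrightarrow> f u \<in> U) \<Longrightarrow> U = {}"
  by (simp add: acyclic_map_def image_subset_iff)

lemma acyclic_mapI: "(\<And>U. U \<subseteq> V \<Longrightarrow> (\<And>u. u \<in> U \<Longrightarrow> f u \<in> U) \<Longrightarrow> U = {}) \<Longrightarrow> acyclic_map V f"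
  by (simp add: acyclic_map_def image_subset_iff)

text \<open>An invariant set stays invariant without \<open>v\<close>, as nothing is sent to
  \<open>v\<close>; and \<open>{v}\<close> itself is not invariant, since
  \<open>f v \<noteq> v\<close>.\<close>

lemma acyclic_map_remove_leaf:
  assumes "v \<in> V" "v \<notin> f ` V"
  shows "acyclic_map V f \<longleftrightarrow> acyclic_map (V - {v}) f"
proof
  assume *: "acyclic_map V f"
  show "acyclic_map (V - {v}) f"
  proof (rule acyclic_mapI)
    fix U assume U: "U \<subseteq> V - {v}" "\<And>u. u \<in> U \<Longrightarrow> f u \<in> U"
    then have "U \<subseteq> V" by blast
    then show "U = {}" using acyclic_mapD[OF * _ U(2)] by blast
  qed
next
  assume *: "acyclic_map (V - {v}) f"
  show "acyclic_map V f"
  proof (rule acyclic_mapI)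
    fix U assume U: "U \<subseteq> V" "\<And>u. u \<in> U \<Longrightarrow> f u \<in> U"
    have no_v: "f u \<noteq> v" if "u \<in> V" for u using that assms(2) by auto
    have "U - {v} = {}"
      by (rule acyclic_mapD[OF *]) (use U no_v in blast)+
    with U no_v show "U = {}" by blast
  qed
qed

section \<open>Level-preserving permutations\<close>

definition level :: "'v set \<Rightarrow> ('v \<Rightarrow> int) \<Rightarrow> int \<Rightarrow> 'v set" where
  "level V a i = {v\<in>V. a v = i}"

definition level_perms :: "'v set \<Rightarrow> ('v \<Rightarrow> int) \<Rightarrow> ('v \<Rightarrow> 'v) set" where
  "level_perms V a = {\<sigma>. \<sigma> permutes V \<and> (\<forall>v\<in>V. a (\<sigma> v) = a v)}"

lemma finite_level [simp]: "finite V \<Longrightarrow> finite (level V a i)"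
  by (simp add: level_def)

lemma finite_level_perms: "finite V \<Longrightarrow> finite (level_perms V a)"
  by (rule finite_subset[OF _ finite_permutations[of V]]) (auto simp: level_perms_def)

lemma level_perms_empty: "level_perms {} a = {id}"
  by (auto simp: level_perms_def)

text \<open>Splits off the image \<open>e = \<sigma> v\<close>: composing with the transposition of
  \<open>v\<close> and \<open>e\<close> makes \<open>v\<close> a fixed point. Both inductions on
  \<open>V\<close> below rest on this.\<close>

lemma bij_betw_level_perms:
  assumes v: "v \<in> V"
  shows "bij_betw (\<lambda>(e, \<sigma>). transpose v e \<circ> \<sigma>) (level V a (a v) \<times> level_perms (V - {v}) a)
           (level_perms V a)"
proof (rule bij_betw_byWitness[where f' = "\<lambda>\<sigma>. (\<sigma> v, transpose v (\<sigma> v) \<circ> \<sigma>)"])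
  show "\<forall>x\<in>level V a (a v) \<times> level_perms (V - {v}) a.
     ((case x of (e, \<sigma>) \<Rightarrow> transpose v e \<circ> \<sigma>) v,
      transpose v ((case x of (e, \<sigma>) \<Rightarrow> transpose v e \<circ> \<sigma>) v) \<circ> (case x of (e, \<sigma>) \<Rightarrow> transpose v e \<circ> \<sigma>)) = x"
  proof (clarsimp simp: level_perms_def)
    fix e \<sigma> assume "\<sigma> permutes V - {v}"
    then have "\<sigma> v = v" by (auto simp: permutes_def)
    then show "transpose v e (\<sigma> v) = e \<and> transpose v (transpose v e (\<sigma> v)) \<circ> (transpose v e \<circ> \<sigma>) = \<sigma>"
      by (simp add: o_assoc[symmetric]) (simp add: fun_eq_iff)
  qed
next
  show "\<forall>\<sigma>\<in>level_perms V a. (\<lambda>(e, \<sigma>). transpose v e \<circ> \<sigma>) (\<sigma> v, transpose v (\<sigma> v) \<circ> \<sigma>) = \<sigma>"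
    by (auto simp: fun_eq_iff)
next
  show "(\<lambda>(e, \<sigma>). transpose v e \<circ> \<sigma>) ` (level V a (a v) \<times> level_perms (V - {v}) a) \<subseteq> level_perms V a"
  proof clarsimp
    fix e \<sigma> assume e: "e \<in> level V a (a v)" and s: "\<sigma> \<in> level_perms (V - {v}) a"
    then have s': "\<sigma> permutes V" "\<sigma> v = v"
      by (auto simp: level_perms_def intro: permutes_subset) (auto simp: permutes_def)
    have "transpose v e \<circ> \<sigma> permutes V"
      using e v s' by (intro permutes_compose permutes_swap_id) (auto simp: level_def)
    moreover have "a (transpose v e (\<sigma> w)) = a w" if "w \<in> V" for w
      using that e s s'(2) by (cases "w = v") (auto simp: level_perms_def level_def transpose_def)
    ultimately show "transpose v e \<circ> \<sigma> \<in> level_perms V a" by (auto simp: level_perms_def)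
  qed
next
  show "(\<lambda>\<sigma>. (\<sigma> v, transpose v (\<sigma> v) \<circ> \<sigma>)) ` level_perms V a \<subseteq> level V a (a v) \<times> level_perms (V - {v}) a"
  proof clarify
    fix \<sigma> assume s: "\<sigma> \<in> level_perms V a"
    then have p: "\<sigma> permutes V" and k: "\<And>w. w \<in> V \<Longrightarrow> a (\<sigma> w) = a w" by (auto simp: level_perms_def)
    have sv: "\<sigma> v \<in> V" using p v permutes_in_image by metis
    have "transpose v (\<sigma> v) \<circ> \<sigma> permutes V"
      using p v sv by (intro permutes_compose permutes_swap_id)
    then have "transpose v (\<sigma> v) \<circ> \<sigma> permutes V - {v}"
      by (rule permutes_superset) auto
    moreover have "a (transpose v (\<sigma> v) (\<sigma> w)) = a w" if "w \<in> V" for w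
      using k[OF that] k[OF v] by (auto simp: transpose_def)
    ultimately show "\<sigma> v \<in> level V a (a v) \<and> transpose v (\<sigma> v) \<circ> \<sigma> \<in> level_perms (V - {v}) a"
      using sv k v by (auto simp: level_perms_def level_def)
  qed
qed

lemma level_remove: "level (V - {v}) a i = level V a i - {v}"
  by (auto simp: level_def)

text \<open>Only the factor of level \<open>a v\<close> can change, and it disappears altogether
  when \<open>v\<close> was alone there, since the product runs over occupied levels.\<close>

lemma prod_levels_remove:
  fixes g g' :: "int \<Rightarrow> 'b::comm_monoid_mult"
  assumes "finite V" "v \<in> V" "\<And>j. j \<noteq> a v \<Longrightarrow> g' j = g j"
  shows "(\<Prod>j\<in>a ` (V - {v}). g' j) =
    (\<Prod>j\<in>a ` V - {a v}. g j) * (if level V a (a v) = {v} then 1 else g' (a v))"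
proof (cases "level V a (a v) = {v}")
  case True
  then have "a ` (V - {v}) = a ` V - {a v}" by (auto simp: level_def)
  then show ?thesis using True assms(3) by (auto intro: prod.cong)
next
  case False
  then obtain w where "w \<in> V" "w \<noteq> v" "a w = a v" using assms(2) by (auto simp: level_def)
  then have "a v \<in> a ` (V - {v})" by (metis DiffI image_eqI singletonD)
  then have "a ` (V - {v}) = insert (a v) (a ` V - {a v})" by auto
  then have "(\<Prod>j\<in>a ` (V - {v}). g' j) = g' (a v) * (\<Prod>j\<in>a ` V - {a v}. g' j)"
    using prod.insert[of "a ` V - {a v}" "a v" g'] assms(1) by auto
  also have "(\<Prod>j\<in>a ` V - {a v}. g' j) = (\<Prod>j\<in>a ` V - {a v}. g j)"
    using assms(3) by (auto intro: prod.cong)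
  finally show ?thesis using False by (simp add: mult.commute)
qed

lemma card_level_perms:
  assumes "finite V"
  shows "card (level_perms V a) = (\<Prod>i\<in>a ` V. fact (card (level V a i)))"
  using assms
proof (induction V rule: finite_psubset_induct)
  case (psubset V)
  show ?case
  proof (cases "V = {}")
    case True
    then show ?thesis by (simp add: level_perms_empty)
  next
    case False
    then obtain v where v: "v \<in> V" by auto
    define L where "L = level V a (a v)"
    have L: "v \<in> L" "finite L" using v psubset by (auto simp: L_def level_def)
    have "card (level_perms V a) = card L * card (level_perms (V - {v}) a)"
      using bij_betw_same_card[OF bij_betw_level_perms[OF v]] by (simp add: card_cartesian_product L_def)
    also have "card (level_perms (V - {v}) a) = (\<Prod>i\<in>a ` (V - {v}). fact (card (level V a i - {v})))"
      using psubset.IH[of "V - {v}"] v by (auto simp: level_remove)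
    also have "\<dots> = (\<Prod>i\<in>a ` V - {a v}. fact (card (level V a i))) * (if L = {v} then 1 else fact (card (L - {v})))"
      unfolding L_def using psubset v by (intro prod_levels_remove) (auto simp: level_def)
    also have "(if L = {v} then 1 else fact (card (L - {v}))) = (fact (card L - 1) :: nat)"
      using L by auto
    also have "card L * ((\<Prod>i\<in>a ` V - {a v}. fact (card (level V a i))) * fact (card L - 1)) =
      (\<Prod>i\<in>a ` V - {a v}. fact (card (level V a i))) * fact (card L)"
      using L by (subst (2) fact_reduce) (auto simp: card_gt_0_iff)
    also have "\<dots> = (\<Prod>i\<in>a ` V. fact (card (level V a i)))"
      using psubset v by (subst prod.remove[of "a ` V" "a v"]) (auto simp: L_def)
    finally show ?thesis .
  qed
qed

text \<open>The quotient of the vertices by levels carries the path towards level \<open>0\<close> as its only spanning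
  tree, because a step from \<open>i\<close> goes to the neighbour \<open>i - sgn i\<close> or away from \<open>0\<close>. Level \<open>0\<close> itself
  is left through an exit.\<close>

definition inward_steps :: "'v set \<Rightarrow> ('v \<Rightarrow> int) \<Rightarrow> ('v \<Rightarrow> 'v) \<Rightarrow> int \<Rightarrow> 'v set" where
  "inward_steps V a f i =
     {v\<in>V. a v = i \<and> (if i = 0 then f v \<notin> V else f v \<in> V \<and> a (f v) = i - sgn i)}"

definition inward_bounded :: "'v set \<Rightarrow> ('v \<Rightarrow> int) \<Rightarrow> ('v \<Rightarrow> 'v) \<Rightarrow> bool" where
  "inward_bounded V a f \<longleftrightarrow> (\<forall>v\<in>V. if f v \<in> V
     then (0 < a v \<longrightarrow> a v - 1 \<le> a (f v)) \<and> (a v < 0 \<longrightarrow> a (f v) \<le> a v + 1) else a v = 0)"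

text \<open>Moves by \<open>sgn j\<close> have length one, so the descent from \<open>j\<close> to
  \<open>0\<close> cannot jump over \<open>g\<close>. It serves with \<open>g = 0\<close> to find an
  exit, and with a level \<open>g\<close> missing from \<open>K\<close> to reach a
  contradiction.\<close>

lemma inward_closed:
  fixes K :: "int set"
  assumes "\<And>j. j \<in> K \<Longrightarrow> j \<noteq> 0 \<Longrightarrow> j - sgn j \<in> K"
    and "j \<in> K" "0 \<le> g \<and> g \<le> j \<or> j \<le> g \<and> g \<le> 0"
  shows "g \<in> K"
  using assms(2,3)
proof (induction "nat \<bar>j - g\<bar>" arbitrary: j)
  case 0
  then show ?case by auto
next
  case (Suc k)
  show ?case
    by (rule Suc.hyps(1)[of "j - sgn j"]) (use Suc assms(1)[of j] in \<open>auto simp: sgn_if split: if_splits\<close>)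
qed

lemma inward_steps_nonempty_closed:
  assumes "\<And>i. i \<in> K \<Longrightarrow> inward_steps V a f i \<noteq> {}" "j \<in> K" "j \<noteq> 0"
  shows "j - sgn j \<in> a ` V"
  using assms(1)[OF assms(2)] assms(3) by (force simp: inward_steps_def split: if_splits)

lemma sum_card_remove:
  assumes "finite L" "C \<subseteq> L"
  shows "(\<Sum>e\<in>L. card (C - {e})) = (card L - 1) * card C"
proof -
  have fC: "finite C" using assms finite_subset by auto
  \<comment> \<open>Adding \<open>card C\<close> avoids truncated subtraction: every
    \<open>e\<close> in \<open>C\<close> supplies the one element that \<open>C - {e}\<close>
    lacks.\<close>
  have "(\<Sum>e\<in>L. card (C - {e})) + card C = (\<Sum>e\<in>L. card (C - {e})) + (\<Sum>e\<in>L. if e \<in> C then 1 else 0)"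
    using assms fC by (simp add: sum.If_cases Int_absorb1)
  also have "\<dots> = (\<Sum>e\<in>L. card C)"
    unfolding sum.distrib[symmetric]
  proof (rule sum.cong)
    fix e assume "e \<in> L"
    show "card (C - {e}) + (if e \<in> C then 1 else 0) = card C"
      using card_gt_0_iff[of C] fC by (auto simp: card_Diff_singleton_if)
  qed simp
  finally have "(\<Sum>e\<in>L. card (C - {e})) + card C = card L * card C" by simp
  then show ?thesis by (simp add: diff_mult_distrib)
qed


text \<open>Remove a vertex \<open>v\<close> without preimage together with the image that \<open>\<sigma>\<close> assigns to it.
  Summing over that image turns the factor \<open>(k - 2)!\<close> of a level of size \<open>k\<close> into \<open>(k - 1)!\<close>, and
  keeps the count of inward steps, since each of them is lost for exactly one choice.\<close>

theorem card_acyclic_level_perms: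
  assumes "finite V" "inward_bounded V a f"
  shows "card {\<sigma>\<in>level_perms V a. acyclic_map V (f \<circ> \<sigma>)} =
    (\<Prod>i\<in>a ` V. fact (card (level V a i) - 1) * card (inward_steps V a f i))"
  using assms
proof (induction V arbitrary: f rule: finite_psubset_induct)
  case (psubset V)
  note fin = \<open>finite V\<close>
  consider "V = {}" | "V \<noteq> {}" "V \<subseteq> f ` V" | v where "v \<in> V" "v \<notin> f ` V" by blast
  then show ?case
  proof cases
    case 1
    then show ?thesis by (simp add: level_perms_empty acyclic_map_def)
  next
    \<comment> \<open>Here \<open>f\<close> maps \<open>V\<close> onto itself, and so does every
      \<open>f \<circ> \<sigma>\<close>: none is acyclic. The product vanishes too: if every level
      had an inward step, the descent would reach level \<open>0\<close>, where an inward step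
      leaves \<open>V\<close>.\<close>
    case 2
    then have fV: "f ` V = V"
      using fin by (metis card_image_le card_seteq finite_imageI)
    have none: "\<not> acyclic_map V (f \<circ> \<sigma>)" if "\<sigma> \<in> level_perms V a" for \<sigma>
    proof -
      have "(f \<circ> \<sigma>) ` V = V" using that fV by (simp only: level_perms_def mem_Collect_eq permutes_image image_comp[symmetric])
      then show ?thesis using 2(1) unfolding acyclic_map_def by (metis order_refl)
    qed
    have "\<exists>i\<in>a ` V. inward_steps V a f i = {}"
    proof (rule ccontr)
      assume "\<not> ?thesis"
      then have *: "\<And>i. i \<in> a ` V \<Longrightarrow> inward_steps V a f i \<noteq> {}" by blast
      obtain v where "v \<in> V" using 2 by auto
      have "0 \<in> a ` V"
        by (rule inward_closed[of _ "a v"])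
          (use inward_steps_nonempty_closed[of "a ` V", OF *] \<open>v \<in> V\<close> in auto)
      from *[OF this] fV show False by (auto simp: inward_steps_def)
    qed
    then obtain i where "i \<in> a ` V" "inward_steps V a f i = {}" by blast
    then have "(\<Prod>i\<in>a ` V. fact (card (level V a i) - 1) * card (inward_steps V a f i)) = 0"
      using fin by (intro prod_zero bexI[of _ i]) simp_all
    moreover have "{\<sigma>\<in>level_perms V a. acyclic_map V (f \<circ> \<sigma>)} = {}" using none by blast
    ultimately show ?thesis by (simp only: card.empty)
  next
    case (3 v)
    define V' L i where "V' = V - {v}" and "L = level V a (a v)" and "i = a v"
    define C where "C = inward_steps V a f i"
    \<comment> \<open>On \<open>V'\<close>, \<open>fe e\<close> agrees with \<open>f\<close> except
      that \<open>e\<close> receives the image of \<open>v\<close>; the old image of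
      \<open>e\<close> goes to \<open>v\<close> and disappears with it. For \<open>e = v\<close> it
      is \<open>f\<close>.\<close>
    define fe where "fe e = f \<circ> transpose v e" for e
    define P where "P = (\<Prod>j\<in>a ` V - {i}. fact (card (level V a j) - 1) * card (inward_steps V a f j))"
    have L: "v \<in> L" "finite L" "L \<subseteq> V" using 3 fin by (auto simp: L_def level_def)
    have CL: "C \<subseteq> L" by (auto simp: C_def L_def inward_steps_def level_def i_def)
    have tr: "transpose v e w \<in> V" "a (transpose v e w) = a w" if "e \<in> L" "w \<in> V" for e w
      using that 3 by (auto simp: transpose_def L_def level_def)
    have tr': "fe e w \<in> V' \<longleftrightarrow> f (transpose v e w) \<in> V" if "e \<in> L" "w \<in> V" for e w
      using imageI[OF tr(1)[OF that], of f] 3 by (auto simp: fe_def V'_def)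
    have bounded: "inward_bounded V' a (fe e)" if e: "e \<in> L" for e
      unfolding inward_bounded_def
    proof
      fix w assume "w \<in> V'"
      then have w: "w \<in> V" by (simp add: V'_def)
      show "if fe e w \<in> V'
        then (0 < a w \<longrightarrow> a w - 1 \<le> a (fe e w)) \<and> (a w < 0 \<longrightarrow> a (fe e w) \<le> a w + 1) else a w = 0"
      proof -
        have "if f (transpose v e w) \<in> V
          then (0 < a (transpose v e w) \<longrightarrow> a (transpose v e w) - 1 \<le> a (f (transpose v e w))) \<and>
            (a (transpose v e w) < 0 \<longrightarrow> a (f (transpose v e w)) \<le> a (transpose v e w) + 1)
          else a (transpose v e w) = 0"
          using psubset.prems tr(1)[OF e w] unfolding inward_bounded_def by blast
        then show ?thesis unfolding tr'[OF e w] tr(2)[OF e w] by (simp add: fe_def)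
      qed
    qed
    have steps: "card (inward_steps V' a (fe e) j) =
        (if j = i then card (C - {e}) else card (inward_steps V a f j))" if e: "e \<in> L" for e j
    proof -
      \<comment> \<open>The vertex \<open>v\<close>, absent from \<open>V'\<close>, corresponds to
        \<open>e\<close>, so \<open>e\<close> is the only inward step of \<open>f\<close> that can
        be lost.\<close>
      have "bij_betw (transpose v e) (inward_steps V' a (fe e) j) (inward_steps V a f j - {e})"
      proof (rule bij_betw_byWitness[where f' = "transpose v e"])
        show "transpose v e ` inward_steps V' a (fe e) j \<subseteq> inward_steps V a f j - {e}"
        proof
          fix x assume "x \<in> transpose v e ` inward_steps V' a (fe e) j"
          then obtain w where w: "x = transpose v e w" "w \<in> inward_steps V' a (fe e) j" by auto
          then have "w \<in> V" "w \<noteq> v" by (auto simp: inward_steps_def V'_def)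
          then show "x \<in> inward_steps V a f j - {e}"
            using w tr[OF e \<open>w \<in> V\<close>] tr'[OF e \<open>w \<in> V\<close>] transpose_eq_iff[of v e w e]
            by (auto simp: inward_steps_def fe_def split: if_splits)
        qed
        show "transpose v e ` (inward_steps V a f j - {e}) \<subseteq> inward_steps V' a (fe e) j"
        proof
          fix x assume "x \<in> transpose v e ` (inward_steps V a f j - {e})"
          then obtain w where w: "x = transpose v e w" "w \<in> inward_steps V a f j" "w \<noteq> e" by auto
          then have "w \<in> V" by (auto simp: inward_steps_def)
          have xV: "x \<in> V" using tr[OF e \<open>w \<in> V\<close>] w by simp
          have "x \<noteq> v" using w transpose_eq_iff[of v e w v] by auto
          have "transpose v e x = w" using w by simp
          then show "x \<in> inward_steps V' a (fe e) j"
            using w xV \<open>x \<noteq> v\<close> tr[OF e \<open>w \<in> V\<close>] tr'[OF e xV]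
            by (auto simp: inward_steps_def fe_def V'_def split: if_splits)
        qed
      qed auto
      then have "card (inward_steps V' a (fe e) j) = card (inward_steps V a f j - {e})"
        by (rule bij_betw_same_card)
      moreover have "inward_steps V a f j - {e} = inward_steps V a f j" if "j \<noteq> i"
        using that e by (auto simp: inward_steps_def L_def level_def i_def)
      ultimately show ?thesis by (auto simp: C_def)
    qed
    have "card {\<sigma>\<in>level_perms V a. acyclic_map V (f \<circ> \<sigma>)} =
      card (SIGMA e:L. {\<sigma>\<in>level_perms V' a. acyclic_map V' (fe e \<circ> \<sigma>)})"
    proof -
      have "bij_betw (\<lambda>(e, \<sigma>). transpose v e \<circ> \<sigma>)
        (SIGMA e:L. {\<sigma>\<in>level_perms V' a. acyclic_map V' (fe e \<circ> \<sigma>)})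
        {\<sigma>\<in>level_perms V a. acyclic_map V (f \<circ> \<sigma>)}"
      proof (rule bij_betw_subset[OF bij_betw_level_perms[OF 3(1), of a]], goal_cases)
        case 1 show ?case by (auto simp: L_def V'_def)
      next
        case 2
        have eq: "acyclic_map V (f \<circ> (transpose v e \<circ> \<sigma>)) \<longleftrightarrow> acyclic_map V' (fe e \<circ> \<sigma>)"
          if "e \<in> L" "\<sigma> \<in> level_perms V' a" for e \<sigma>
        proof -
          have "\<sigma> permutes V" using that(2) unfolding level_perms_def V'_def
            by (auto intro: permutes_subset)
          then have "transpose v e \<circ> \<sigma> permutes V"
            using that 3 L by (intro permutes_compose permutes_swap_id) auto
          then have "(f \<circ> (transpose v e \<circ> \<sigma>)) ` V = f ` V"
            by (metis image_comp permutes_image)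
          with 3 have "v \<notin> (f \<circ> (transpose v e \<circ> \<sigma>)) ` V" by simp
          from acyclic_map_remove_leaf[OF 3(1) this] show ?thesis
            by (simp add: V'_def fe_def o_assoc)
        qed
        have im: "(\<lambda>(e, \<sigma>). transpose v e \<circ> \<sigma>) ` (L \<times> level_perms V' a) = level_perms V a"
          using bij_betw_level_perms[OF 3(1), of a] unfolding bij_betw_def L_def V'_def by blast
        show ?case (is "?l = ?r")
        proof
          show "?l \<subseteq> ?r" using eq im by (auto simp: image_iff)
          show "?r \<subseteq> ?l"
          proof
            fix \<tau> assume t: "\<tau> \<in> ?r"
            then have "\<tau> \<in> (\<lambda>(e, \<sigma>). transpose v e \<circ> \<sigma>) ` (L \<times> level_perms V' a)"
              unfolding im by simp
            then obtain e \<sigma> where "e \<in> L" "\<sigma> \<in> level_perms V' a" "\<tau> = transpose v e \<circ> \<sigma>"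
              by auto
            then show "\<tau> \<in> ?l" using t eq by force
          qed
        qed
      qed
      then show ?thesis by (simp add: bij_betw_same_card)
    qed
    also have "\<dots> = (\<Sum>e\<in>L. card {\<sigma>\<in>level_perms V' a. acyclic_map V' (fe e \<circ> \<sigma>)})"
      using L fin by (subst card_SigmaI) (auto simp: V'_def finite_level_perms)
    also have "\<dots> = (\<Sum>e\<in>L. \<Prod>j\<in>a ` V'. fact (card (level V' a j) - 1) * card (inward_steps V' a (fe e) j))"
    proof (rule sum.cong[OF refl])
      fix e assume "e \<in> L"
      have "V' \<subset> V" using 3 by (auto simp: V'_def)
      from psubset.IH[OF this bounded[OF \<open>e \<in> L\<close>]]
      show "card {\<sigma>\<in>level_perms V' a. acyclic_map V' (fe e \<circ> \<sigma>)} =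
        (\<Prod>j\<in>a ` V'. fact (card (level V' a j) - 1) * card (inward_steps V' a (fe e) j))" .
    qed
    also have "\<dots> = (\<Sum>e\<in>L. P * (if L = {v} then 1 else fact (card L - 2) * card (C - {e})))"
    proof (rule sum.cong[OF refl])
      fix e assume e: "e \<in> L"
      have "(\<Prod>j\<in>a ` (V - {v}). fact (card (level V' a j) - 1) * card (inward_steps V' a (fe e) j)) =
        P * (if level V a (a v) = {v} then 1 else
          fact (card (level V' a (a v)) - 1) * card (inward_steps V' a (fe e) (a v)))"
        unfolding P_def i_def
      proof (rule prod_levels_remove[OF fin 3(1)])
        fix j assume "j \<noteq> a v"
        then have "level V' a j = level V a j" by (auto simp: level_def V'_def)
        with \<open>j \<noteq> a v\<close> show "fact (card (level V' a j) - 1) * card (inward_steps V' a (fe e) j) =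
          fact (card (level V a j) - 1) * card (inward_steps V a f j)"
          by (simp add: steps[OF e] i_def)
      qed
      moreover have "card (level V' a (a v)) = card L - 1"
        using L by (simp add: V'_def level_remove L_def)
      ultimately show "(\<Prod>j\<in>a ` V'. fact (card (level V' a j) - 1) * card (inward_steps V' a (fe e) j)) =
        P * (if L = {v} then 1 else fact (card L - 2) * card (C - {e}))"
        using steps[OF e, of i] by (simp add: V'_def L_def i_def numeral_2_eq_2)
    qed
    also have "\<dots> = P * (fact (card L - 1) * card C)"
    proof (cases "L = {v}")
      case False
      then have "card L \<noteq> 1" using L(1) by (auto simp: card_1_singleton_iff)
      moreover have "card L \<noteq> 0" using L by auto
      ultimately have "fact (card L - 1) = (card L - 1) * (fact (card L - 2) :: nat)"
        by (subst fact_reduce) (auto simp: numeral_2_eq_2)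
      with False show ?thesis
        by (simp add: sum_distrib_left[symmetric] sum_card_remove[OF L(2) CL])
    next
      case True
      \<comment> \<open>With \<open>v\<close> alone on its level the factor is \<open>1\<close>, so
        \<open>card C = 1\<close> is needed unless another level makes the product zero. Otherwise
        \<open>f v\<close> lies in \<open>V\<close> on another level, and all levels of
        \<open>V'\<close> have inward steps, so the descent from \<open>f v\<close> towards
        \<open>0\<close> stays in levels of \<open>V'\<close>. But \<open>i\<close> lies between
        \<open>0\<close> and the level of \<open>f v\<close>, so the descent must meet level
        \<open>i\<close>, which \<open>V'\<close> lacks.\<close>
      have "card C = 1 \<or> P = 0"
      proof (rule ccontr)
        assume neg: "\<not> ?thesis"
        have "C = {} \<or> C = {v}" using CL True by auto
        with neg have "v \<notin> C" by auto
        have image: "a ` V' = a ` V - {i}" using True by (auto simp: V'_def L_def level_def i_def)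
        have pos: "card (inward_steps V a f j) \<noteq> 0" if "j \<in> a ` V'" for j
          using neg that fin unfolding image P_def by simp
        have closed: "j - sgn j \<in> a ` V'" if "j \<in> a ` V'" "j \<noteq> 0" for j
        proof -
          have "inward_steps V' a (fe v) j \<noteq> {}" if "j \<in> a ` V'" for j
            using pos[OF that] steps[OF L(1), of j] that unfolding image by force
          then show ?thesis using inward_steps_nonempty_closed[of "a ` V'"] that by blast
        qed
        have fv: "f v \<in> V" using psubset.prems 3 \<open>v \<notin> C\<close>
          unfolding C_def inward_bounded_def inward_steps_def i_def by (auto split: if_splits)
        moreover have "f v \<noteq> v" using 3 by (metis image_eqI)
        ultimately have j: "a (f v) \<in> a ` V'" by (auto simp: V'_def)
        with image have "a (f v) \<noteq> i" by auto
        moreover have "(0 < i \<longrightarrow> i - 1 \<le> a (f v)) \<and> (i < 0 \<longrightarrow> a (f v) \<le> i + 1)"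
          using psubset.prems 3 fv unfolding inward_bounded_def i_def by auto
        moreover have "i \<noteq> 0 \<longrightarrow> a (f v) \<noteq> i - sgn i"
          using \<open>v \<notin> C\<close> 3 fv by (auto simp: C_def inward_steps_def i_def)
        ultimately have "0 \<le> i \<and> i \<le> a (f v) \<or> a (f v) \<le> i \<and> i \<le> 0"
          by (auto simp: sgn_if split: if_splits)
        from inward_closed[OF closed j this] image show False by auto
      qed
      with True show ?thesis by auto
    qed
    also have "\<dots> = (\<Prod>i\<in>a ` V. fact (card (level V a i) - 1) * card (inward_steps V a f i))"
      using fin 3 unfolding P_def by (subst prod.remove[of "a ` V" i]) (auto simp: L_def i_def C_def)
    finally show ?thesis .
  qed
qed

section \<open>Counting acyclic parent maps\<close>

text \<open>The value \<open>0\<close>, which is never a vertex, marks the missing parent of the root.\<close>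

definition inward_targets :: "nat set \<Rightarrow> (nat \<Rightarrow> int) \<Rightarrow> int \<Rightarrow> nat set" where
  "inward_targets V a i = (if i = 0 then {0} else level V a (i - sgn i))"

definition step_targets :: "int set \<Rightarrow> nat set \<Rightarrow> (nat \<Rightarrow> int) \<Rightarrow> int \<Rightarrow> nat set" where
  "step_targets S V a i = {u\<in>V. i - a u \<in> S}"

text \<open>Acyclicity is left out on purpose: the remaining constraints survive composition with
  level-preserving permutations. Extensionality makes a map determined by its values on
  \<open>V\<close>.\<close>

definition parent_maps :: "int set \<Rightarrow> nat set \<Rightarrow> (nat \<Rightarrow> int) \<Rightarrow> (nat \<Rightarrow> nat) set" where
  "parent_maps S V a = {h \<in> extensional V.
     (\<forall>v\<in>V. h v = 0 \<and> a v = 0 \<or> h v \<in> step_targets S V a (a v)) \<and> (\<exists>!v. v \<in> V \<and> h v = 0)}"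

lemma prod_group_levels:
  fixes g :: "'v \<Rightarrow> 'b::comm_monoid_mult"
  assumes "finite V"
  shows "(\<Prod>v\<in>V. g v) = (\<Prod>i\<in>a ` V. \<Prod>v\<in>level V a i. g v)"
  using prod.group[of V "a ` V" a g] assms by (simp add: level_def)

text \<open>The condition on \<open>-1\<close> is tied to the presence of a vertex with negative
  abscissa, which covers both alternatives \<open>min S = -1\<close> and \<open>l = 0\<close> at
  once.\<close>

locale inward_step_set =
  fixes S :: "int set" and V :: "nat set" and a :: "nat \<Rightarrow> int"
  assumes finite_V: "finite V" and zero_V: "0 \<notin> V"
    and step_le: "\<And>s. s \<in> S \<Longrightarrow> s \<le> 1"
    and one_S: "1 \<in> S"
    and negative: "\<And>v. v \<in> V \<Longrightarrow> a v < 0 \<Longrightarrow> -1 \<in> S \<and> (\<forall>s\<in>S. -1 \<le> s)"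
begin

lemma inward_targets_subset:
  assumes "v \<in> V" "a v \<noteq> 0"
  shows "inward_targets V a (a v) \<subseteq> step_targets S V a (a v)"
proof (cases "0 < a v")
  case True
  then show ?thesis using one_S by (auto simp: inward_targets_def step_targets_def level_def)
next
  case False
  then have "a v < 0" using assms by auto
  with negative[OF assms(1)] show ?thesis
    by (auto simp: inward_targets_def step_targets_def level_def)
qed

lemma parent_map_cases:
  assumes "h \<in> parent_maps S V a" "v \<in> V"
  obtains "h v = 0" "h v \<notin> V" "a v = 0" | "h v \<noteq> 0" "h v \<in> V" "a v - a (h v) \<in> S"
proof -
  have "h v = 0 \<and> a v = 0 \<or> h v \<in> step_targets S V a (a v)"
    using assms by (simp add: parent_maps_def)
  then show thesis
  proof
    assume "h v = 0 \<and> a v = 0"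
    then show thesis using that(1) zero_V by simp
  next
    assume *: "h v \<in> step_targets S V a (a v)"
    then have "h v \<in> V" by (simp add: step_targets_def)
    moreover from this have "h v \<noteq> 0" using zero_V by metis
    ultimately show thesis using that(2) * by (simp add: step_targets_def)
  qed
qed

lemma inward_bounded_parent_map:
  assumes h: "h \<in> parent_maps S V a"
  shows "inward_bounded V a h"
  unfolding inward_bounded_def
proof
  fix v assume v: "v \<in> V"
  from h v show "if h v \<in> V
     then (0 < a v \<longrightarrow> a v - 1 \<le> a (h v)) \<and> (a v < 0 \<longrightarrow> a (h v) \<le> a v + 1) else a v = 0"
  proof (cases rule: parent_map_cases)
    case 1
    then show ?thesis by simp
  next
    case 2
    have "a v - a (h v) \<le> 1" using step_le 2 by blast
    moreover have "-1 \<le> a v - a (h v)" if "a v < 0" using negative[OF v that] 2 by blast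
    ultimately show ?thesis using 2 by auto
  qed
qed

lemma inward_steps_parent_map:
  assumes h: "h \<in> parent_maps S V a"
  shows "inward_steps V a h i = {v\<in>level V a i. h v \<in> inward_targets V a i}"
proof -
  have "h v \<notin> V \<longleftrightarrow> h v = 0" if "v \<in> V" for v
    using h that by (cases rule: parent_map_cases) auto
  then show ?thesis
    unfolding inward_steps_def level_def inward_targets_def by (cases "i = 0") auto
qed

lemma finite_parent_maps: "finite (parent_maps S V a)"
proof (rule finite_subset)
  show "parent_maps S V a \<subseteq> V \<rightarrow>\<^sub>E insert 0 V"
  proof
    fix h assume h: "h \<in> parent_maps S V a"
    then have "h v \<in> insert 0 V" if "v \<in> V" for v
      using that by (cases rule: parent_map_cases) auto
    moreover have "h \<in> extensional V" using h by (simp add: parent_maps_def)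
    ultimately show "h \<in> V \<rightarrow>\<^sub>E insert 0 V" by (simp add: PiE_def Pi_def)
  qed
  show "finite (V \<rightarrow>\<^sub>E insert 0 V)" using finite_V by (simp add: finite_PiE)
qed

text \<open>The constraint on \<open>h v\<close> depends on \<open>v\<close> only through
  \<open>a v\<close>, and \<open>\<sigma>\<close> merely moves the root within its level.\<close>

lemma parent_maps_comp_level_perm:
  assumes h: "h \<in> parent_maps S V a" and s: "\<sigma> \<in> level_perms V a"
  shows "h \<circ> \<sigma> \<in> parent_maps S V a"
proof -
  have p: "\<sigma> permutes V" and k: "\<And>v. v \<in> V \<Longrightarrow> a (\<sigma> v) = a v" using s by (auto simp: level_perms_def)
  have in_V: "\<sigma> v \<in> V \<longleftrightarrow> v \<in> V" for v using p by (rule permutes_in_image)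
  have "h \<circ> \<sigma> \<in> extensional V"
    using h p by (auto simp: parent_maps_def extensional_def permutes_not_in)
  moreover have "\<forall>v\<in>V. (h \<circ> \<sigma>) v = 0 \<and> a v = 0 \<or> (h \<circ> \<sigma>) v \<in> step_targets S V a (a v)"
  proof
    fix v assume v: "v \<in> V"
    then have "\<sigma> v \<in> V" using in_V by simp
    then have "h (\<sigma> v) = 0 \<and> a (\<sigma> v) = 0 \<or> h (\<sigma> v) \<in> step_targets S V a (a (\<sigma> v))"
      using h by (simp add: parent_maps_def)
    then show "(h \<circ> \<sigma>) v = 0 \<and> a v = 0 \<or> (h \<circ> \<sigma>) v \<in> step_targets S V a (a v)"
      by (simp add: k[OF v])
  qed
  moreover have "\<exists>!v. v \<in> V \<and> (h \<circ> \<sigma>) v = 0"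
  proof -
    obtain r where r: "r \<in> V" "h r = 0" "\<And>v. v \<in> V \<Longrightarrow> h v = 0 \<Longrightarrow> v = r"
      using h unfolding parent_maps_def by auto
    obtain w where w: "r = \<sigma> w" using permutes_surj[OF p] by blast
    show ?thesis
    proof (rule ex1I[of _ w])
      show "w \<in> V \<and> (h \<circ> \<sigma>) w = 0" using r w in_V by auto
      fix v assume "v \<in> V \<and> (h \<circ> \<sigma>) v = 0"
      then have "\<sigma> v = \<sigma> w" using r(3)[of "\<sigma> v"] w in_V by auto
      then show "v = w" using permutes_inj[OF p] by (auto dest: injD)
    qed
  qed
  ultimately show ?thesis by (simp add: parent_maps_def)
qed

lemma bij_betw_parent_maps_comp:
  assumes s: "\<sigma> \<in> level_perms V a"
  shows "bij_betw (\<lambda>h. h \<circ> \<sigma>) (parent_maps S V a) (parent_maps S V a)"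
proof (rule bij_betw_byWitness[where f' = "\<lambda>h. h \<circ> inv \<sigma>"])
  have p: "\<sigma> permutes V" and k: "\<And>v. v \<in> V \<Longrightarrow> a (\<sigma> v) = a v" using s by (auto simp: level_perms_def)
  have "a (inv \<sigma> v) = a v" if "v \<in> V" for v
    using k[of "inv \<sigma> v"] permutes_in_image[OF permutes_inv[OF p]] that permutes_inverses(1)[OF p] by simp
  then have i: "inv \<sigma> \<in> level_perms V a" using p by (auto simp: level_perms_def permutes_inv)
  show "\<forall>h\<in>parent_maps S V a. h \<circ> \<sigma> \<circ> inv \<sigma> = h"
    using permutes_inverses[OF p] by (auto simp: fun_eq_iff)
  show "\<forall>h\<in>parent_maps S V a. h \<circ> inv \<sigma> \<circ> \<sigma> = h"
    using permutes_inverses[OF p] by (auto simp: fun_eq_iff)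
  show "(\<lambda>h. h \<circ> \<sigma>) ` parent_maps S V a \<subseteq> parent_maps S V a"
    using parent_maps_comp_level_perm s by auto
  show "(\<lambda>h. h \<circ> inv \<sigma>) ` parent_maps S V a \<subseteq> parent_maps S V a"
    using parent_maps_comp_level_perm i by auto
qed

text \<open>Both sides count pairs of a parent map and a choice, on each level, of one of its inward
  steps.\<close>

lemma sum_prod_inward_steps:
  assumes "0 \<in> a ` V"
  shows "(\<Sum>h\<in>parent_maps S V a. \<Prod>i\<in>a ` V. card (inward_steps V a h i)) =
    (\<Prod>i\<in>a ` V. card (level V a i) * card (inward_targets V a i)
      * card (step_targets S V a i) ^ (card (level V a i) - 1))"
proof -
  define X where "X = PiE (a ` V) (level V a)"
  \<comment> \<open>Once the chosen vertices \<open>x\<close> are fixed, all images are independent.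
    Uniqueness of the root is built in: \<open>step_targets\<close> omits \<open>0\<close>, so only
    the chosen vertex of level \<open>0\<close> can be sent to \<open>0\<close>.\<close>
  define F where "F x = PiE V (\<lambda>v. if v = x (a v) then inward_targets V a (a v) else step_targets S V a (a v))" for x
  define I where "I h = PiE (a ` V) (inward_steps V a h)" for h
  have xD: "x i \<in> V" "a (x i) = i" if "x \<in> X" "i \<in> a ` V" for x i
    using that by (auto simp: X_def level_def PiE_def Pi_def)
  have zero_step: "0 \<notin> step_targets S V a i" for i using zero_V by (auto simp: step_targets_def)
  have zero_inward: "0 \<in> inward_targets V a i \<longleftrightarrow> i = 0" for i
    using zero_V by (auto simp: inward_targets_def level_def)
  have swap: "h \<in> parent_maps S V a \<and> x \<in> I h \<longleftrightarrow> x \<in> X \<and> h \<in> F x" for h x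
  proof
    assume hx: "h \<in> parent_maps S V a \<and> x \<in> I h"
    then have x: "x \<in> X" by (auto simp: I_def X_def inward_steps_def level_def PiE_def Pi_def)
    have hxi: "h (x i) \<in> inward_targets V a i" if "i \<in> a ` V" for i
      using hx that by (auto simp: I_def inward_steps_parent_map PiE_def Pi_def)
    \<comment> \<open>A vertex that is not chosen and violates its step condition would be sent to
      \<open>0\<close> from level \<open>0\<close>; but \<open>x 0\<close> already is the only
      root.\<close>
    have "h v \<in> step_targets S V a (a v)" if v: "v \<in> V" "v \<noteq> x (a v)" for v
    proof (rule ccontr)
      assume "\<not> ?thesis"
      then have v0: "h v = 0" "a v = 0" using hx v unfolding parent_maps_def by auto
      have "h (x 0) = 0" "x 0 \<in> V" using hxi[OF assms] xD[OF x assms] by (auto simp: inward_targets_def)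
      then have "v = x 0" using hx v v0 unfolding parent_maps_def by auto
      then show False using v v0 by simp
    qed
    moreover have "h \<in> extensional V" using hx by (simp add: parent_maps_def)
    ultimately have "h \<in> F x" unfolding F_def PiE_def Pi_def
      using hxi by (simp) (metis (lifting) imageI)
    with x show "x \<in> X \<and> h \<in> F x" by simp
  next
    assume hx: "x \<in> X \<and> h \<in> F x"
    have hv: "h v \<in> (if v = x (a v) then inward_targets V a (a v) else step_targets S V a (a v))"
      if "v \<in> V" for v using hx that unfolding F_def by (auto simp: PiE_def Pi_def)
    have x: "x \<in> X" using hx by simp
    have "h v = 0 \<and> a v = 0 \<or> h v \<in> step_targets S V a (a v)" if "v \<in> V" for v
      using hv[OF that] inward_targets_subset[OF that]
      by (auto simp: inward_targets_def split: if_splits)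
    moreover have "\<exists>!v. v \<in> V \<and> h v = 0"
    proof (rule ex1I[of _ "x 0"])
      show "x 0 \<in> V \<and> h (x 0) = 0"
        using hv[of "x 0"] xD[OF x assms] by (auto simp: inward_targets_def)
      fix v assume "v \<in> V \<and> h v = 0"
      then show "v = x 0" using hv[of v] zero_step[of "a v"] zero_inward[of "a v"]
        by (auto split: if_splits)
    qed
    ultimately have h: "h \<in> parent_maps S V a" using hx by (auto simp: parent_maps_def F_def PiE_def)
    have "x i \<in> inward_steps V a h i" if i: "i \<in> a ` V" for i
      using hv[of "x i"] xD[OF x i] by (simp add: inward_steps_parent_map[OF h] level_def)
    then have "x \<in> I h" using x by (auto simp: I_def X_def PiE_def)
    with h show "h \<in> parent_maps S V a \<and> x \<in> I h" by simp
  qed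
  have fin_I: "finite (I h)" for h
    using finite_V by (auto simp: I_def inward_steps_def intro!: finite_PiE)
  have fin_X: "finite X" using finite_V by (auto simp: X_def intro!: finite_PiE)
  have fin_F: "finite (F x)" for x
    using finite_V by (auto simp: F_def inward_targets_def step_targets_def intro!: finite_PiE)
  have card_F: "card (F x) = (\<Prod>i\<in>a ` V. card (inward_targets V a i)
      * card (step_targets S V a i) ^ (card (level V a i) - 1))" if x: "x \<in> X" for x
  proof -
    have "card (F x) = (\<Prod>v\<in>V. if v = x (a v) then card (inward_targets V a (a v)) else card (step_targets S V a (a v)))"
      unfolding F_def using finite_V by (simp add: card_PiE if_distrib cong: if_cong)
    also have "\<dots> = (\<Prod>i\<in>a ` V. \<Prod>v\<in>level V a i. if v = x (a v) then card (inward_targets V a (a v)) else card (step_targets S V a (a v)))"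
      by (rule prod_group_levels[OF finite_V])
    also have "\<dots> = (\<Prod>i\<in>a ` V. card (inward_targets V a i) * card (step_targets S V a i) ^ (card (level V a i) - 1))"
    proof (rule prod.cong[OF refl])
      fix i assume i: "i \<in> a ` V"
      have xi: "x i \<in> level V a i" using xD[OF x i] by (simp add: level_def)
      have "(\<Prod>v\<in>level V a i. if v = x (a v) then card (inward_targets V a (a v)) else card (step_targets S V a (a v)))
        = (\<Prod>v\<in>level V a i. if v = x i then card (inward_targets V a i) else card (step_targets S V a i))"
        by (rule prod.cong) (auto simp: level_def)
      also have "\<dots> = card (inward_targets V a i) * (\<Prod>v\<in>level V a i - {x i}. card (step_targets S V a i))"
        using xi finite_V by (subst prod.remove[of _ "x i"]) (auto intro!: prod.cong)
      finally show "(\<Prod>v\<in>level V a i. if v = x (a v) then card (inward_targets V a (a v)) else card (step_targets S V a (a v)))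
        = card (inward_targets V a i) * card (step_targets S V a i) ^ (card (level V a i) - 1)"
        using xi by simp
    qed
    finally show ?thesis .
  qed
  have "(\<Sum>h\<in>parent_maps S V a. \<Prod>i\<in>a ` V. card (inward_steps V a h i)) = (\<Sum>h\<in>parent_maps S V a. card (I h))"
    using finite_V by (simp add: I_def card_PiE)
  also have "\<dots> = card (SIGMA h:parent_maps S V a. I h)"
    using finite_parent_maps fin_I by simp
  also have "\<dots> = card (SIGMA x:X. F x)"
  proof (rule bij_betw_same_card[of prod.swap])
    show "bij_betw prod.swap (SIGMA h:parent_maps S V a. I h) (SIGMA x:X. F x)"
    proof (rule bij_betw_byWitness[where f' = prod.swap])
      show "prod.swap ` (SIGMA h:parent_maps S V a. I h) \<subseteq> (SIGMA x:X. F x)" using swap by fastforce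
      show "prod.swap ` (SIGMA x:X. F x) \<subseteq> (SIGMA h:parent_maps S V a. I h)" using swap by fastforce
    qed auto
  qed
  also have "\<dots> = (\<Sum>x\<in>X. card (F x))" using fin_X fin_F by simp
  also have "\<dots> = card X * (\<Prod>i\<in>a ` V. card (inward_targets V a i)
      * card (step_targets S V a i) ^ (card (level V a i) - 1))"
    using card_F by simp
  also have "card X = (\<Prod>i\<in>a ` V. card (level V a i))"
    using finite_V by (simp add: X_def card_PiE)
  finally show ?thesis by (simp add: prod.distrib mult.assoc)
qed

text \<open>Every level-preserving permutation acts bijectively on the parent maps, so the acyclic ones
  are counted by averaging over the orbits, on each of which their number is known.\<close>

theorem card_acyclic_parent_maps:
  assumes zero: "0 \<in> a ` V"
  shows "card {h\<in>parent_maps S V a. acyclic_map V h} =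
    (\<Prod>i\<in>a ` V. card (inward_targets V a i)
      * card (step_targets S V a i) ^ (card (level V a i) - 1))"
proof -
  let ?P = "parent_maps S V a" and ?G = "level_perms V a"
  define T where "T = card {h\<in>?P. acyclic_map V h}"
  have fin_G: "finite ?G" using finite_V by (rule finite_level_perms)
  have same: "card {h\<in>?P. acyclic_map V (h \<circ> \<sigma>)} = T" if "\<sigma> \<in> ?G" for \<sigma>
  proof -
    have "bij_betw (\<lambda>h. h \<circ> \<sigma>) {h\<in>?P. acyclic_map V (h \<circ> \<sigma>)} {h\<in>?P. acyclic_map V h}"
    proof (rule bij_betw_subset[OF bij_betw_parent_maps_comp[OF that]])
      have im: "(\<lambda>h. h \<circ> \<sigma>) ` ?P = ?P"
        using bij_betw_parent_maps_comp[OF that] by (simp add: bij_betw_def)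
      show "(\<lambda>h. h \<circ> \<sigma>) ` {h\<in>?P. acyclic_map V (h \<circ> \<sigma>)} = {h\<in>?P. acyclic_map V h}" (is "?l = ?r")
      proof
        show "?l \<subseteq> ?r" using im by blast
        show "?r \<subseteq> ?l"
        proof
          fix g assume g: "g \<in> ?r"
          then have "g \<in> (\<lambda>h. h \<circ> \<sigma>) ` ?P" unfolding im by simp
          then show "g \<in> ?l" using g by blast
        qed
      qed
    qed auto
    then show ?thesis unfolding T_def by (rule bij_betw_same_card)
  qed
  have "(\<Prod>i\<in>a ` V. fact (card (level V a i))) * T = (\<Sum>\<sigma>\<in>?G. card {h\<in>?P. acyclic_map V (h \<circ> \<sigma>)})"
    using same finite_V by (simp add: card_level_perms)
  \<comment> \<open>The pairs of \<open>\<sigma>\<close> and \<open>h\<close> with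
    \<open>h \<circ> \<sigma>\<close> acyclic, counted in the other order.\<close>
  also have "\<dots> = (\<Sum>h\<in>?P. card {\<sigma>\<in>?G. acyclic_map V (h \<circ> \<sigma>)})"
    by (rule sum_multicount_gen[OF fin_G finite_parent_maps]) simp
  also have "\<dots> = (\<Sum>h\<in>?P. \<Prod>i\<in>a ` V. fact (card (level V a i) - 1) * card (inward_steps V a h i))"
    using card_acyclic_level_perms[OF finite_V inward_bounded_parent_map] by (intro sum.cong) auto
  also have "\<dots> = (\<Prod>i\<in>a ` V. fact (card (level V a i) - 1)) *
      (\<Sum>h\<in>?P. \<Prod>i\<in>a ` V. card (inward_steps V a h i))"
    by (simp add: prod.distrib sum_distrib_left)
  also have "\<dots> = (\<Prod>i\<in>a ` V. fact (card (level V a i))) * (\<Prod>i\<in>a ` V. card (inward_targets V a i)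
      * card (step_targets S V a i) ^ (card (level V a i) - 1))"
    unfolding sum_prod_inward_steps[OF zero] prod.distrib[symmetric]
  proof (rule prod.cong[OF refl])
    fix i assume "i \<in> a ` V"
    then have "0 < card (level V a i)" using finite_V by (auto simp: card_gt_0_iff level_def)
    then have "fact (card (level V a i)) = card (level V a i) * (fact (card (level V a i) - 1) :: nat)"
      by (simp add: fact_reduce)
    then show "fact (card (level V a i) - 1) * (card (level V a i) * card (inward_targets V a i)
        * card (step_targets S V a i) ^ (card (level V a i) - 1)) =
      fact (card (level V a i)) * (card (inward_targets V a i)
        * card (step_targets S V a i) ^ (card (level V a i) - 1))"
      by (simp only: mult_ac)
  qed
  finally show ?thesis using finite_V by (simp add: T_def prod_zero_iff)
qed

end

section \<open>Trees and parent maps\<close>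

text \<open>If a vertex \<open>y\<close> is visited twice, the loop between the two visits is cut
  out, which shortens the walk and keeps its ends.\<close>

lemma walk_imp_simple_path:
  assumes "walk V E p"
  obtains q where "simple_path V E q" "hd q = hd p" "last q = last p"
  using assms
proof (induction "length p" arbitrary: p thesis rule: less_induct)
  case less
  show thesis
  proof (cases "distinct p")
    case True
    then show thesis using less.prems by (auto simp: simple_path_def)
  next
    case False
    then obtain xs ys zs y where p: "p = xs @ [y] @ ys @ [y] @ zs"
      using not_distinct_decomp by blast
    define q where "q = xs @ [y] @ zs"
    have "walk V E q" using less.prems(2)
      by (auto simp: walk_def p q_def successively_append_iff successively_Cons)
    moreover have "length q < length p" "hd q = hd p" "last q = last p"
      by (auto simp: p q_def hd_append)
    ultimately show thesis using less.hyps[of q] less.prems(1) by metis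
  qed
qed

lemma walk_rev: "walk V E p \<Longrightarrow> walk V E (rev p)"
  by (simp add: walk_def successively_rev insert_commute)

lemma walk_join:
  assumes "walk V E p" "walk V E q" "last p = hd q"
  shows "walk V E (p @ tl q)" "last (p @ tl q) = last q"
  using assms by (cases q; auto simp: walk_def successively_append_iff successively_Cons)+

definition parent_edges :: "'v set \<Rightarrow> ('v \<Rightarrow> 'v) \<Rightarrow> 'v set set" where
  "parent_edges V h = {{v, h v} |v. v \<in> V \<and> h v \<in> V}"

lemma edge_parent_edges:
  "{u, v} \<in> parent_edges V h \<longleftrightarrow> u \<in> V \<and> v \<in> V \<and> (h u = v \<or> h v = u)"
  unfolding parent_edges_def by (auto simp: doubleton_eq_iff)

section \<open>The graph of an acyclic parent map is a tree\<close>

locale parent_tree =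
  fixes V :: "'v set" and h :: "'v \<Rightarrow> 'v" and \<rho> :: 'v
  assumes root: "\<rho> \<in> V" "h \<rho> \<notin> V"
    and inner: "\<And>v. v \<in> V \<Longrightarrow> v \<noteq> \<rho> \<Longrightarrow> h v \<in> V"
    and acyclic: "acyclic_map V h"
begin

abbreviation "E \<equiv> parent_edges V h"

lemma simple_graph: "simple_graph V E"
proof -
  have "h v \<noteq> v" if "v \<in> V" for v
    using acyclic_mapD[OF acyclic, of "{v}"] that by auto
  then show ?thesis unfolding simple_graph_def parent_edges_def by fastforce
qed

text \<open>The vertices that cannot be reached form a set closed under \<open>h\<close>: a walk to
  \<open>h v\<close> would extend to \<open>v\<close>, and the root is reachable. Acyclicity makes
  this set empty.\<close>

lemma reachable:
  assumes "v \<in> V"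
  obtains p where "walk V E p" "hd p = \<rho>" "last p = v"
proof -
  let ?U = "{v\<in>V. \<nexists>p. walk V E p \<and> hd p = \<rho> \<and> last p = v}"
  have "?U = {}"
  proof (rule acyclic_mapD[OF acyclic])
    fix v assume v: "v \<in> ?U"
    have "walk V E [\<rho>]" using root by (simp add: walk_def)
    with v have "v \<noteq> \<rho>" by force
    then have hv: "h v \<in> V" using v inner by blast
    moreover have False if "walk V E p" "hd p = \<rho>" "last p = h v" for p
    proof -
      have "{h v, v} \<in> E" using v hv by (simp add: edge_parent_edges)
      then have "walk V E (p @ [v])"
        using that v by (auto simp: walk_def successively_append_iff)
      moreover have "hd (p @ [v]) = \<rho>" using that by (auto simp: walk_def)
      ultimately show False using v by auto
    qed
    ultimately show "h v \<in> ?U" by blast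
  qed blast
  then show thesis using assms that by blast
qed

lemma connected_graph: "connected_graph V E"
  unfolding connected_graph_def
proof (intro conjI ballI)
  show "V \<noteq> {}" using root by blast
  fix u v assume "u \<in> V" "v \<in> V"
  obtain p where p: "walk V E p" "hd p = \<rho>" "last p = u" using reachable[OF \<open>u \<in> V\<close>] .
  obtain q where q: "walk V E q" "hd q = \<rho>" "last q = v" using reachable[OF \<open>v \<in> V\<close>] .
  have ne: "p \<noteq> []" using p by (simp add: walk_def)
  have "last (rev p) = hd q" using ne p q by (simp add: last_rev)
  note j = walk_join[OF walk_rev[OF p(1)] q(1) this]
  moreover have "hd (rev p @ tl q) = u" using ne p by (simp add: hd_rev)
  ultimately show "\<exists>p. walk V E p \<and> hd p = u \<and> last p = v" using q by metis
qed

text \<open>A path that has gone from a parent down to a child cannot turn back: the only upward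
  neighbour of \<open>y\<close> is \<open>x\<close>, which a path without repetition does not
  revisit.\<close>

lemma oriented_step:
  assumes "successively (\<lambda>u v. {u, v} \<in> E) (x # y # zs)" "distinct (x # y # zs)" "h y = x"
  shows "successively (\<lambda>u v. h v = u) (x # y # zs)"
  using assms
proof (induction zs arbitrary: x y)
  case Nil
  then show ?case by simp
next
  case (Cons z zs)
  from Cons.prems have "h z = y" by (auto simp: edge_parent_edges)
  with Cons show ?case by auto
qed

text \<open>The root has no parent in \<open>V\<close>, so the first edge goes down, and then all
  others do.\<close>

lemma oriented_from_root:
  assumes "simple_path V E p" "hd p = \<rho>"
  shows "successively (\<lambda>u v. h v = u) p"
proof -
  consider "p = []" | x where "p = [x]" | y zs where "p = \<rho> # y # zs"
    using assms(2) by (cases p rule: remdups_adj.cases) auto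
  then show ?thesis
  proof cases
    case 3
    then have "h y = \<rho>" using assms root by (auto simp: simple_path_def walk_def edge_parent_edges)
    then show ?thesis using oriented_step assms unfolding 3 simple_path_def walk_def by blast
  qed auto
qed

text \<open>Links the path-based notion of child to the parent map. It translates the condition on
  abscissas, and it recovers the parent map from the edges and the root.\<close>

lemma child_of_iff: "child_of V E \<rho> u v \<longleftrightarrow> v \<in> V \<and> v \<noteq> \<rho> \<and> h v = u"
proof
  assume "child_of V E \<rho> u v"
  then obtain p where p: "simple_path V E (p @ [u, v])" "hd (p @ [u, v]) = \<rho>"
    unfolding child_of_def by blast
  from oriented_from_root[OF p] have "h v = u" by (simp add: successively_append_iff)
  moreover have "v \<noteq> \<rho>" using p by (cases p) (auto simp: simple_path_def)
  ultimately show "v \<in> V \<and> v \<noteq> \<rho> \<and> h v = u" using p by (auto simp: simple_path_def walk_def)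
next
  assume v: "v \<in> V \<and> v \<noteq> \<rho> \<and> h v = u"
  obtain p where p: "walk V E p" "hd p = \<rho>" "last p = v" using reachable v by blast
  obtain q where q: "simple_path V E q" "hd q = \<rho>" "last q = v"
    using walk_imp_simple_path[OF p(1)] p by metis
  have ne: "q \<noteq> []" using q by (simp add: simple_path_def walk_def)
  have "butlast q \<noteq> []"
  proof
    assume "butlast q = []"
    then have "q = [v]" using ne q append_butlast_last_id[OF ne] by simp
    then show False using q v by simp
  qed
  then obtain r w where "butlast q = r @ [w]" by (metis append_butlast_last_id)
  then have qr: "q = r @ [w, v]" using append_butlast_last_id[OF ne] q by simp
  have "h v = w" using oriented_from_root[OF q(1,2)] by (simp add: qr successively_append_iff)
  then have "simple_path V E (r @ [u, v]) \<and> hd (r @ [u, v]) = \<rho>" using v q qr by simp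
  then show "child_of V E \<rho> u v" unfolding child_of_def by blast
qed

text \<open>A vertex of a cycle that is farthest from the root would have both its neighbours in the
  cycle as parents.\<close>

lemma no_cycle:
  assumes fin: "finite V"
  shows "\<not> graph_cycle V E p"
proof
  assume cyc: "graph_cycle V E p"
  \<comment> \<open>\<open>R\<close> relates each parent to its children. Acyclicity makes it
    well-founded; as \<open>V\<close> is finite, so is its converse, which yields a vertex of the
    cycle with no child in the cycle.\<close>
  define R where "R = {(h v, v) |v. v \<in> V \<and> h v \<in> V}"
  have "wf R"
  proof (rule wfI_min)
    fix x :: 'v and Q assume xQ: "x \<in> Q"
    show "\<exists>z\<in>Q. \<forall>y. (y, z) \<in> R \<longrightarrow> y \<notin> Q"
    proof (rule ccontr)
      assume neg: "\<not> ?thesis"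
      then have *: "z \<in> V \<and> h z \<in> Q" if "z \<in> Q" for z using that unfolding R_def by blast
      then have "Q = {}" by (intro acyclic_mapD[OF acyclic]) auto
      with xQ show False by blast
    qed
  qed
  moreover have "finite R"
    by (rule finite_subset[of _ "(\<lambda>v. (h v, v)) ` V"]) (use fin in \<open>auto simp: R_def\<close>)
  ultimately have "wf (R\<inverse>)" using finite_acyclic_wf_converse wf_acyclic by blast
  moreover have p: "p \<noteq> []" "set p \<subseteq> V" "successively (\<lambda>u v. {u, v} \<in> E) p" "distinct p"
      "3 \<le> length p" "{last p, hd p} \<in> E"
    using cyc by (auto simp: graph_cycle_def simple_path_def walk_def)
  ultimately obtain x where x: "x \<in> set p" "\<And>y. (y, x) \<in> R\<inverse> \<Longrightarrow> y \<notin> set p"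
    using wfE_min[of "R\<inverse>" "hd p" "set p"] by (metis hd_in_set)
  have parent: "h x = y" if "y \<in> set p" "{x, y} \<in> E" for y
  proof (rule ccontr)
    assume "h x \<noteq> y"
    then have "h y = x" "x \<in> V" "y \<in> V" using that(2) by (auto simp: edge_parent_edges)
    then have "(y, x) \<in> R\<inverse>" by (auto simp: R_def)
    with x(2) that(1) show False by blast
  qed
  obtain i where i: "i < length p" "p ! i = x" using x(1) by (auto simp: in_set_conv_nth)
  have step: "{p ! j, p ! Suc j} \<in> E" if "Suc j < length p" for j
    using p(3) that by (simp add: successively_conv_nth)
  have closing: "{p ! (length p - 1), p ! 0} \<in> E" using p by (simp add: last_conv_nth hd_conv_nth)
  \<comment> \<open>\<open>j\<close> and \<open>k\<close> are the positions before and after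
    \<open>i\<close> on the cycle, with wrap-around. They differ because the cycle has at least
    three vertices.\<close>
  define j where "j = (if i = 0 then length p - 1 else i - 1)"
  define k where "k = (if Suc i = length p then 0 else Suc i)"
  have jk: "j < length p" "k < length p" "j \<noteq> k" using i(1) p(5) by (auto simp: j_def k_def)
  have "{x, p ! j} \<in> E"
    using step[of "i - 1"] closing i by (auto simp: j_def insert_commute)
  moreover have "{x, p ! k} \<in> E"
  proof (cases "Suc i = length p")
    case True
    then have "length p - 1 = i" by simp
    with closing i True show ?thesis by (simp add: k_def)
  next
    case False
    with step[of i] i show ?thesis by (simp add: k_def)
  qed
  ultimately have "p ! j = p ! k" using parent jk by (metis nth_mem)
  with jk p(4) show False by (simp add: nth_eq_iff_index_eq)
qed

lemma tree_graph: "finite V \<Longrightarrow> tree_graph V E"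
  using simple_graph connected_graph no_cycle by (simp add: tree_graph_def)

end

section \<open>Every rooted tree comes from a parent map\<close>

text \<open>Each vertex takes as parent a neighbour closer to the root, which prevents cycles of
  \<open>h\<close>. An edge of \<open>E\<close> that is not a parent edge would close a cycle with
  the path of parent edges between its ends.\<close>

lemma tree_graph_parent_map:
  assumes tree: "tree_graph V E" and \<rho>: "\<rho> \<in> V" and z: "z \<notin> V"
  obtains h where "h \<in> extensional V" "h \<rho> = z" "parent_tree V h \<rho>" "E = parent_edges V h"
proof -
  define d where "d v = (LEAST n. \<exists>p. walk V E p \<and> hd p = \<rho> \<and> last p = v \<and> length p = n)" for v
  have closer: "\<exists>u\<in>V. {u, v} \<in> E \<and> d u < d v" if v: "v \<in> V" "v \<noteq> \<rho>" for v
  proof -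
    have "\<exists>n p. walk V E p \<and> hd p = \<rho> \<and> last p = v \<and> length p = n"
      using tree \<rho> v unfolding tree_graph_def connected_graph_def by blast
    then have "\<exists>p. walk V E p \<and> hd p = \<rho> \<and> last p = v \<and> length p = d v"
      unfolding d_def by (rule LeastI_ex)
    then obtain p where p: "walk V E p" "hd p = \<rho>" "last p = v" "length p = d v" by blast
    have ne: "p \<noteq> []" using p by (simp add: walk_def)
    have "butlast p \<noteq> []"
    proof
      assume "butlast p = []"
      then have "p = [v]" using ne p append_butlast_last_id[OF ne] by simp
      then show False using p v by simp
    qed
    then obtain r w where "butlast p = r @ [w]" by (metis append_butlast_last_id)
    then have pr: "p = r @ [w, v]" using append_butlast_last_id[OF ne] p by simp
    have "walk V E (r @ [w])" "hd (r @ [w]) = \<rho>"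
      using p(1,2) by (auto simp: pr walk_def successively_append_iff hd_append split: if_splits)
    then have "d w \<le> length (r @ [w])" unfolding d_def by (intro Least_le) auto
    then have "d w < d v" using p(4) by (simp add: pr)
    moreover have "w \<in> V" "{w, v} \<in> E" using p(1) by (auto simp: pr walk_def successively_append_iff)
    ultimately show ?thesis by blast
  qed
  define h where "h = (\<lambda>v\<in>V. if v = \<rho> then z else SOME u. u \<in> V \<and> {u, v} \<in> E \<and> d u < d v)"
  have h: "h v \<in> V \<and> {h v, v} \<in> E \<and> d (h v) < d v" if v: "v \<in> V" "v \<noteq> \<rho>" for v
    using someI_ex[of "\<lambda>u. u \<in> V \<and> {u, v} \<in> E \<and> d u < d v"] closer[OF v] v by (auto simp: h_def)
  have h\<rho>: "h \<rho> = z" using \<rho> by (simp add: h_def)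
  have pt: "parent_tree V h \<rho>"
  proof
    show "\<rho> \<in> V" "h \<rho> \<notin> V" using \<rho> z h\<rho> by auto
    show "h v \<in> V" if "v \<in> V" "v \<noteq> \<rho>" for v using h[OF that] by simp
    show "acyclic_map V h"
    proof (rule acyclic_mapI)
      fix U assume U: "U \<subseteq> V" "\<And>u. u \<in> U \<Longrightarrow> h u \<in> U"
      show "U = {}"
      proof (rule ccontr)
        assume "U \<noteq> {}"
        then obtain u where u: "u \<in> U" "\<And>w. w \<in> U \<Longrightarrow> d u \<le> d w"
          using ex_has_least_nat[of "\<lambda>u. u \<in> U" _ d] by blast
        have "h u \<in> V" using U u by blast
        then have "u \<noteq> \<rho>" using h\<rho> z by auto
        then have "d (h u) < d u" using h U u by blast
        with u U show False by (meson not_less)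
      qed
    qed
  qed
  interpret parent_tree V h \<rho> by (rule pt)
  have sub: "parent_edges V h \<subseteq> E"
  proof
    fix e assume "e \<in> parent_edges V h"
    then obtain v where v: "e = {v, h v}" "v \<in> V" "h v \<in> V" by (auto simp: parent_edges_def)
    then have "v \<noteq> \<rho>" using root by auto
    then show "e \<in> E" using h v by (simp add: insert_commute)
  qed
  have "E \<subseteq> parent_edges V h"
  proof
    fix e assume e: "e \<in> E"
    then obtain u w where uw: "u \<in> V" "w \<in> V" "u \<noteq> w" "e = {u, w}"
      using tree unfolding tree_graph_def simple_graph_def by blast
    obtain p where p: "walk V (parent_edges V h) p" "hd p = u" "last p = w"
      using connected_graph uw unfolding connected_graph_def by blast
    obtain q where q: "simple_path V (parent_edges V h) q" "hd q = u" "last q = w"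
      using walk_imp_simple_path[OF p(1)] p by metis
    show "e \<in> parent_edges V h"
    proof (rule ccontr)
      assume ne: "e \<notin> parent_edges V h"
      have "3 \<le> length q"
      proof (cases q rule: remdups_adj.cases)
        case (3 x y zs)
        then have "zs \<noteq> []" using q uw ne by (auto simp: simple_path_def walk_def)
        then show ?thesis using 3 by (cases zs) auto
      qed (use q uw in \<open>auto simp: simple_path_def walk_def\<close>)
      moreover have "simple_path V E q"
        using q(1) sub unfolding simple_path_def walk_def by (auto intro: successively_mono)
      ultimately have "graph_cycle V E q"
        using q e uw by (simp add: graph_cycle_def insert_commute)
      then show False using tree by (auto simp: tree_graph_def)
    qed
  qed
  with sub have "E = parent_edges V h" by blast
  moreover have "h \<in> extensional V" by (simp add: h_def)
  ultimately show thesis using that h\<rho> pt by blast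
qed

section \<open>Vertical profiles\<close>

text \<open>The multinomial coefficient, in a form without division. The induction chooses the fibre
  over the new value \<open>i\<close> and leaves a function on its complement.\<close>

lemma card_functions_with_level_sizes:
  fixes n :: "int \<Rightarrow> nat"
  assumes "finite I" "finite V" "card V = (\<Sum>i\<in>I. n i)"
  shows "card {a \<in> V \<rightarrow>\<^sub>E I. \<forall>i\<in>I. card (level V a i) = n i} * (\<Prod>i\<in>I. fact (n i)) = fact (card V)"
  using assms
proof (induction I arbitrary: V rule: finite_induct)
  case empty
  then show ?case by simp
next
  case (insert i I)
  let ?A = "\<lambda>V I. {a \<in> V \<rightarrow>\<^sub>E I. \<forall>i\<in>I. card (level V a i) = n i}"
  let ?F = "{F. F \<subseteq> V \<and> card F = n i}"
  have "bij_betw (\<lambda>a. (level V a i, restrict a (V - level V a i))) (?A V (insert i I)) (SIGMA F:?F. ?A (V - F) I)"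
  proof (rule bij_betw_byWitness[where f' = "\<lambda>(F, b). \<lambda>v\<in>V. if v \<in> F then i else b v"])
    show "\<forall>a\<in>?A V (insert i I). (case (level V a i, restrict a (V - level V a i)) of
        (F, b) \<Rightarrow> \<lambda>v\<in>V. if v \<in> F then i else b v) = a"
    proof
      fix a assume "a \<in> ?A V (insert i I)"
      then have "a \<in> extensional V" by (simp add: PiE_def)
      then show "(case (level V a i, restrict a (V - level V a i)) of
        (F, b) \<Rightarrow> \<lambda>v\<in>V. if v \<in> F then i else b v) = a"
        by (auto simp: fun_eq_iff level_def extensional_def)
    qed
    have lv: "level V (\<lambda>v\<in>V. if v \<in> F then i else b v) i = F"
      if "F \<subseteq> V" "b \<in> (V - F) \<rightarrow>\<^sub>E I" for F b
      using that insert.hyps(2) by (auto simp: level_def PiE_def Pi_def split: if_splits)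
    show "\<forall>x\<in>SIGMA F:?F. ?A (V - F) I.
        (level V (case x of (F, b) \<Rightarrow> \<lambda>v\<in>V. if v \<in> F then i else b v) i,
         restrict (case x of (F, b) \<Rightarrow> \<lambda>v\<in>V. if v \<in> F then i else b v)
           (V - level V (case x of (F, b) \<Rightarrow> \<lambda>v\<in>V. if v \<in> F then i else b v) i)) = x"
    proof
      fix x assume "x \<in> (SIGMA F:?F. ?A (V - F) I)"
      then obtain F b where x: "x = (F, b)" "F \<subseteq> V" "b \<in> (V - F) \<rightarrow>\<^sub>E I" by auto
      have "restrict (\<lambda>v\<in>V. if v \<in> F then i else b v) (V - F) = b"
        using x(3) by (auto simp: fun_eq_iff PiE_def extensional_def restrict_def)
      with lv[OF x(2,3)] show "(level V (case x of (F, b) \<Rightarrow> \<lambda>v\<in>V. if v \<in> F then i else b v) i,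
         restrict (case x of (F, b) \<Rightarrow> \<lambda>v\<in>V. if v \<in> F then i else b v)
           (V - level V (case x of (F, b) \<Rightarrow> \<lambda>v\<in>V. if v \<in> F then i else b v) i)) = x"
        by (simp add: x(1))
    qed
    show "(\<lambda>a. (level V a i, restrict a (V - level V a i))) ` ?A V (insert i I) \<subseteq> (SIGMA F:?F. ?A (V - F) I)"
    proof (rule image_subsetI)
      fix a assume a: "a \<in> ?A V (insert i I)"
      let ?W = "V - level V a i"
      have "restrict a ?W \<in> ?W \<rightarrow>\<^sub>E I" using a by (auto simp: level_def PiE_def Pi_def)
      moreover have "level ?W (restrict a ?W) j = level V a j" if "j \<in> I" for j
        using that insert.hyps(2) by (auto simp: level_def)
      ultimately show "(level V a i, restrict a ?W) \<in> (SIGMA F:?F. ?A (V - F) I)"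
        using a by (auto simp: level_def)
    qed
    show "(\<lambda>(F, b). \<lambda>v\<in>V. if v \<in> F then i else b v) ` (SIGMA F:?F. ?A (V - F) I) \<subseteq> ?A V (insert i I)"
    proof (rule image_subsetI)
      fix x assume "x \<in> (SIGMA F:?F. ?A (V - F) I)"
      then obtain F b where x: "x = (F, b)" "F \<subseteq> V" "card F = n i" "b \<in> (V - F) \<rightarrow>\<^sub>E I"
        "\<forall>j\<in>I. card (level (V - F) b j) = n j" by auto
      let ?a = "\<lambda>v\<in>V. if v \<in> F then i else b v"
      have "?a \<in> V \<rightarrow>\<^sub>E insert i I" using x(4) by (auto simp: PiE_def Pi_def)
      moreover have "level V ?a j = level (V - F) b j" if "j \<in> I" for j
        using that insert.hyps(2) by (auto simp: level_def split: if_splits)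
      ultimately show "(case x of (F, b) \<Rightarrow> \<lambda>v\<in>V. if v \<in> F then i else b v) \<in> ?A V (insert i I)"
        using x lv[OF x(2,4)] by simp
    qed
  qed
  then have "card (?A V (insert i I)) = card (SIGMA F:?F. ?A (V - F) I)"
    by (rule bij_betw_same_card)
  also have "\<dots> = (\<Sum>F\<in>?F. card (?A (V - F) I))"
  proof (rule card_SigmaI)
    show "finite ?F" using insert.prems(1) by simp
    have "finite ((V - F) \<rightarrow>\<^sub>E I)" for F using insert by (simp add: finite_PiE)
    then show "\<forall>F\<in>?F. finite (?A (V - F) I)" by simp
  qed
  finally have "card (?A V (insert i I)) * (\<Prod>i\<in>I. fact (n i)) =
    (\<Sum>F\<in>?F. card (?A (V - F) I) * (\<Prod>i\<in>I. fact (n i)))"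
    by (simp add: sum_distrib_right)
  also have "\<dots> = (\<Sum>F\<in>?F. fact (card V - n i))"
  proof (rule sum.cong[OF refl])
    fix F assume F: "F \<in> ?F"
    then have c: "card (V - F) = card V - n i" using insert.prems(1) by (auto simp: card_Diff_subset finite_subset)
    also have "\<dots> = (\<Sum>i\<in>I. n i)" using insert by simp
    finally have "card (?A (V - F) I) * (\<Prod>i\<in>I. fact (n i)) = fact (card (V - F))"
      using insert.prems(1) by (intro insert.IH) auto
    then show "card (?A (V - F) I) * (\<Prod>i\<in>I. fact (n i)) = fact (card V - n i)" by (simp add: c)
  qed
  also have "\<dots> = (card V choose n i) * fact (card V - n i)"
    using n_subsets[OF insert.prems(1)] by simp
  finally have "card (?A V (insert i I)) * (\<Prod>i\<in>I. fact (n i)) = (card V choose n i) * fact (card V - n i)" .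
  then have "card (?A V (insert i I)) * (\<Prod>i\<in>insert i I. fact (n i)) =
    fact (n i) * fact (card V - n i) * (card V choose n i)"
    using insert.hyps by (simp add: ac_simps)
  also have "\<dots> = fact (card V)"
    using insert by (intro binomial_fact_lemma) simp
  finally show ?case .
qed

section \<open>Evaluating the factors of the levels\<close>

lemma prod_shift_up:
  fixes n :: "int \<Rightarrow> nat"
  assumes "0 \<le> r"
  shows "(\<Prod>i\<in>{1..r}. n (i - 1)) * n r = n 0 * (\<Prod>i\<in>{1..r}. n i)"
  using assms
proof (induction r rule: int_ge_induct)
  case (step r)
  then have "{1..r + 1} = insert (r + 1) {1..r}" by auto
  then show ?case using step.IH by (simp add: ac_simps)
qed simp

lemma prod_shift_down:
  fixes n :: "int \<Rightarrow> nat"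
  assumes "l \<le> 0"
  shows "(\<Prod>i\<in>{l..-1}. n (i + 1)) * n l = n 0 * (\<Prod>i\<in>{l..-1}. n i)"
  using assms
proof (induction l rule: int_le_induct)
  case (step l)
  then have "{l - 1..-1} = insert (l - 1) {l..-1}" by auto
  then show ?case using step.IH by (simp add: ac_simps)
qed simp

text \<open>Origin of the factor \<open>n 0 / (n l * n r)\<close>. Shifting towards \<open>0\<close>
  trades \<open>n r\<close> for \<open>n 0\<close> on the positive side and \<open>n l\<close> for
  \<open>n 0\<close> on the negative side, while level \<open>0\<close> contributes \<open>1\<close>
  in place of \<open>n 0\<close>.\<close>

lemma prod_inward_shift:
  fixes n :: "int \<Rightarrow> nat"
  assumes "l \<le> 0" "0 \<le> r"
  shows "(\<Prod>i\<in>{l..r}. if i = 0 then 1 else n (i - sgn i)) * (n l * n r) = n 0 * (\<Prod>i\<in>{l..r}. n i)"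
proof -
  have split: "(\<Prod>i\<in>{l..r}. g i) = (\<Prod>i\<in>{l..-1}. g i) * g 0 * (\<Prod>i\<in>{1..r}. g i)" for g :: "int \<Rightarrow> nat"
  proof -
    have "{l..r} = ({l..-1} \<union> {0}) \<union> {1..r}" using assms by auto
    then show ?thesis by (simp add: prod.union_disjoint)
  qed
  have "(\<Prod>i\<in>{l..-1}. if i = 0 then 1 else n (i - sgn i)) = (\<Prod>i\<in>{l..-1}. n (i + 1))"
    by (rule prod.cong) auto
  moreover have "(\<Prod>i\<in>{1..r}. if i = 0 then 1 else n (i - sgn i)) = (\<Prod>i\<in>{1..r}. n (i - 1))"
    by (rule prod.cong) auto
  ultimately have "(\<Prod>i\<in>{l..r}. if i = 0 then 1 else n (i - sgn i)) * (n l * n r) =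
    ((\<Prod>i\<in>{l..-1}. n (i + 1)) * n l) * ((\<Prod>i\<in>{1..r}. n (i - 1)) * n r)"
    unfolding split by simp
  also have "\<dots> = n 0 * (\<Prod>i\<in>{l..r}. n i)"
    unfolding prod_shift_up[OF assms(2)] prod_shift_down[OF assms(1)] split by simp
  finally show ?thesis .
qed

text \<open>The targets are sorted by the step \<open>s\<close> that leads from them to level
  \<open>i\<close>. Only occupied levels matter, so the sum is finite even for infinite
  \<open>S\<close>.\<close>

lemma card_step_targets:
  assumes "finite V" "\<And>i. card (level V a i) = n i"
  shows "card (step_targets S V a i) = step_sum S n i"
proof -
  let ?T = "{s\<in>S. n (i - s) \<noteq> 0}"
  have ne: "n (i - s) \<noteq> 0 \<longleftrightarrow> level V a (i - s) \<noteq> {}" for s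
    using assms(1) by (simp flip: assms(2))
  have "?T \<subseteq> (\<lambda>v. i - a v) ` V" unfolding ne by (force simp: level_def)
  then have "finite ?T" using assms(1) finite_subset by blast
  moreover have "step_targets S V a i = (\<Union>s\<in>?T. level V a (i - s))"
  proof
    show "step_targets S V a i \<subseteq> (\<Union>s\<in>?T. level V a (i - s))"
    proof
      fix u assume u: "u \<in> step_targets S V a i"
      then have "u \<in> level V a (i - (i - a u))" by (simp add: step_targets_def level_def)
      moreover from this have "i - a u \<in> ?T" using u ne[of "i - a u"] by (auto simp: step_targets_def)
      ultimately show "u \<in> (\<Union>s\<in>?T. level V a (i - s))" by blast
    qed
    show "(\<Union>s\<in>?T. level V a (i - s)) \<subseteq> step_targets S V a i"
      by (auto simp: step_targets_def level_def)
  qed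
  moreover have "card (\<Union>s\<in>?T. level V a (i - s)) = (\<Sum>s\<in>?T. card (level V a (i - s)))"
    by (rule card_UN_disjoint) (use \<open>finite ?T\<close> assms(1) in \<open>auto simp: level_def\<close>)
  ultimately show ?thesis by (simp add: step_sum_def assms(2))
qed

section \<open>Embedded trees with a given profile\<close>

definition profile_maps :: "nat \<Rightarrow> int \<Rightarrow> int \<Rightarrow> (int \<Rightarrow> nat) \<Rightarrow> (nat \<Rightarrow> int) set" where
  "profile_maps N l r n = {a \<in> {1..N} \<rightarrow>\<^sub>E {l..r}. \<forall>i\<in>{l..r}. card (level {1..N} a i) = n i}"

lemma profile_maps_image:
  assumes a: "a \<in> profile_maps N l r n" and "\<forall>i\<in>{l..r}. 0 < n i"
  shows "a ` {1..N} = {l..r}"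
proof
  show "a ` {1..N} \<subseteq> {l..r}" using a by (auto simp: profile_maps_def PiE_def Pi_def)
  show "{l..r} \<subseteq> a ` {1..N}"
  proof
    fix i assume i: "i \<in> {l..r}"
    then have "0 < card (level {1..N} a i)" using assms by (simp add: profile_maps_def)
    then have "level {1..N} a i \<noteq> {}" by (metis card.empty less_irrefl)
    then show "i \<in> a ` {1..N}" by (auto simp: level_def)
  qed
qed

lemma profile_mapsD:
  assumes a: "a \<in> profile_maps N l r n" and "\<forall>i. i < l \<or> r < i \<longrightarrow> n i = 0"
  shows "card (level {1..N} a i) = n i"
proof (cases "i \<in> {l..r}")
  case True
  then show ?thesis using a by (simp add: profile_maps_def)
next
  case False
  have "a v \<in> {l..r}" if "v \<in> {1..N}" for v using a that by (simp add: profile_maps_def PiE_def Pi_def)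
  then have "level {1..N} a i = {}" using False by (auto simp: level_def)
  then show ?thesis using False assms(2) by auto
qed

text \<open>Counting vertices level by level determines \<open>N\<close>. Conversely, positivity of
  \<open>n\<close> makes every level of \<open>{l..r}\<close> occupied, so that \<open>l\<close> and
  \<open>r\<close> are the extreme abscissas.\<close>

lemma has_vertical_profile_iff:
  assumes n_pos: "\<forall>i\<in>{l..r}. 0 < n i" and lr: "l \<le> r" and ext: "a \<in> extensional {1..N}" and N: "1 \<le> N"
  shows "has_vertical_profile N a l r n \<longleftrightarrow> N = (\<Sum>i\<in>{l..r}. n i) \<and> a \<in> profile_maps N l r n"
proof
  assume p: "has_vertical_profile N a l r n"
  have ne: "finite (a ` {1..N})" "a ` {1..N} \<noteq> {}" using N by auto
  have bounds: "a v \<in> {l..r}" if "v \<in> {1..N}" for v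
    using p that Min_le[OF ne(1)] Max_ge[OF ne(1)] by (simp add: has_vertical_profile_def)
  then have "a \<in> profile_maps N l r n"
    using p ext by (simp add: profile_maps_def has_vertical_profile_def level_def PiE_def Pi_def)
  moreover have "N = (\<Sum>i\<in>{l..r}. n i)"
  proof -
    have "a ` {1..N} \<subseteq> {l..r}" using bounds by blast
    then have "(\<Sum>i\<in>{l..r}. \<Sum>v\<in>{v\<in>{1..N}. a v = i}. 1) = (\<Sum>v\<in>{1..N}. 1::nat)"
      by (intro sum.group) auto
    then show ?thesis using p by (simp add: has_vertical_profile_def)
  qed
  ultimately show "N = (\<Sum>i\<in>{l..r}. n i) \<and> a \<in> profile_maps N l r n" by simp
next
  assume a: "N = (\<Sum>i\<in>{l..r}. n i) \<and> a \<in> profile_maps N l r n"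
  then have image: "a ` {1..N} = {l..r}" using profile_maps_image n_pos by blast
  have "Min {l..r} = l" "Max {l..r} = r" using lr by (auto intro: Min_eqI Max_eqI)
  then show "has_vertical_profile N a l r n"
    using conjunct2[OF a] unfolding has_vertical_profile_def image profile_maps_def level_def by simp
qed

lemma parent_maps_root:
  assumes h: "h \<in> parent_maps S V a" "acyclic_map V h" and zero: "0 \<notin> V"
  defines "\<rho> \<equiv> THE v. v \<in> V \<and> h v = 0"
  shows "parent_tree V h \<rho>" "h \<rho> = 0" "a \<rho> = 0"
    and "\<And>v. v \<in> V \<Longrightarrow> v \<noteq> \<rho> \<Longrightarrow> a v - a (h v) \<in> S"
proof -
  have u: "\<exists>!v. v \<in> V \<and> h v = 0" using h by (simp add: parent_maps_def)
  have r: "\<rho> \<in> V \<and> h \<rho> = 0" unfolding \<rho>_def by (rule theI'[OF u])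
  have cases: "h v = 0 \<and> a v = 0 \<or> h v \<in> step_targets S V a (a v)" if "v \<in> V" for v
    using h(1) that by (simp add: parent_maps_def)
  have step: "h v \<in> step_targets S V a (a v)" if "v \<in> V" "v \<noteq> \<rho>" for v
  proof -
    have "h v \<noteq> 0" using that u r by metis
    then show ?thesis using cases[OF that(1)] by simp
  qed
  show "parent_tree V h \<rho>"
  proof
    show "\<rho> \<in> V" "h \<rho> \<notin> V" using r zero by auto
    show "h v \<in> V" if "v \<in> V" "v \<noteq> \<rho>" for v using step[OF that] by (simp add: step_targets_def)
    show "acyclic_map V h" by (rule h(2))
  qed
  show "h \<rho> = 0" using r by simp
  show "a \<rho> = 0" using cases[of \<rho>] r zero by (simp add: step_targets_def)
  show "\<And>v. v \<in> V \<Longrightarrow> v \<noteq> \<rho> \<Longrightarrow> a v - a (h v) \<in> S" using step by (simp add: step_targets_def)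
qed

text \<open>Injective because edges and root determine the parent of every other vertex, while the
  root is always sent to \<open>0\<close>; surjective because every rooted tree has a parent map
  with exit \<open>0\<close>.\<close>

lemma bij_betw_embedded_trees:
  assumes n_pos: "\<forall>i\<in>{l..r}. 0 < n i" and lr: "l \<le> r" and N: "N = (\<Sum>i\<in>{l..r}. n i)"
  shows "bij_betw (\<lambda>(a, h). (N, parent_edges {1..N} h, THE v. v \<in> {1..N} \<and> h v = 0, a))
    (SIGMA a:profile_maps N l r n. {h\<in>parent_maps S {1..N} a. acyclic_map {1..N} h})
    (embedded_cayley_trees_with_profile S l r n)"
    (is "bij_betw ?\<phi> ?X ?Y")
proof -
  let ?V = "{1..N}"
  have zero: "0 \<notin> ?V" by simp
  have "inj_on ?\<phi> ?X"
  proof (rule inj_onI)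
    fix x y assume x: "x \<in> ?X" and y: "y \<in> ?X" and eq: "?\<phi> x = ?\<phi> y"
    obtain a h where xa: "x = (a, h)" by force
    obtain b g where yb: "y = (b, g)" by force
    define \<rho> where "\<rho> = (THE v. v \<in> ?V \<and> h v = 0)"
    have ab: "a = b" and E: "parent_edges ?V h = parent_edges ?V g" and r: "\<rho> = (THE v. v \<in> ?V \<and> g v = 0)"
      using eq by (auto simp: xa yb \<rho>_def)
    have h: "h \<in> parent_maps S ?V a" "acyclic_map ?V h" and g: "g \<in> parent_maps S ?V a" "acyclic_map ?V g"
      using x y by (auto simp: xa yb ab)
    note H = parent_maps_root[OF h zero, folded \<rho>_def] and G = parent_maps_root[OF g zero, folded r]
    have "h v = g v" for v
    proof -
      consider "v \<notin> ?V" | "v = \<rho>" | "v \<in> ?V" "v \<noteq> \<rho>" by blast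
      then show ?thesis
      proof cases
        case 1
        then show ?thesis using h(1) g(1) unfolding parent_maps_def extensional_def by simp
      next
        case 2
        then show ?thesis using H(2) G(2) by simp
      next
        case 3
        then have "child_of ?V (parent_edges ?V h) \<rho> (h v) v"
          using parent_tree.child_of_iff[OF H(1)] by blast
        then show ?thesis unfolding E using parent_tree.child_of_iff[OF G(1)] by simp
      qed
    qed
    then show "x = y" using xa yb ab by auto
  qed
  moreover have "?\<phi> ` ?X \<subseteq> ?Y"
  proof (rule image_subsetI)
    fix x assume x: "x \<in> ?X"
    obtain a h where xa: "x = (a, h)" by force
    define \<rho> where "\<rho> = (THE v. v \<in> ?V \<and> h v = 0)"
    have a: "a \<in> profile_maps N l r n" and h: "h \<in> parent_maps S ?V a" "acyclic_map ?V h"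
      using x by (auto simp: xa)
    note H = parent_maps_root[OF h zero, folded \<rho>_def]
    interpret parent_tree ?V h \<rho> by (rule H(1))
    have ext: "a \<in> extensional ?V" using a by (simp add: profile_maps_def PiE_def)
    have "a v' - a v \<in> S" if "child_of ?V E \<rho> v v'" for v v'
      using that H(4) unfolding child_of_iff by blast
    then have "embedded_cayley_tree S N E \<rho> a"
      using tree_graph root ext H(3) by (simp add: embedded_cayley_tree_def rooted_cayley_tree_def)
    moreover have "has_vertical_profile N a l r n"
      using has_vertical_profile_iff[OF n_pos lr ext] root a N by simp
    ultimately show "?\<phi> x \<in> ?Y"
      by (simp add: xa embedded_cayley_trees_with_profile_def \<rho>_def)
  qed
  moreover have "?Y \<subseteq> ?\<phi> ` ?X"
  proof
    fix y assume "y \<in> ?Y"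
    then obtain M E \<rho> a where y: "y = (M, E, \<rho>, a)" and emb: "embedded_cayley_tree S M E \<rho> a"
      and prof: "has_vertical_profile M a l r n"
      by (auto simp: embedded_cayley_trees_with_profile_def)
    have tree: "tree_graph {1..M} E" "\<rho> \<in> {1..M}" and ext: "a \<in> extensional {1..M}" and "a \<rho> = 0"
      and steps: "\<And>v v'. v \<in> {1..M} \<Longrightarrow> v' \<in> {1..M} \<Longrightarrow> child_of {1..M} E \<rho> v v' \<Longrightarrow> a v' - a v \<in> S"
      using emb by (auto simp: embedded_cayley_tree_def rooted_cayley_tree_def)
    have "1 \<le> M" using tree(2) by auto
    then have MN: "M = N" and a: "a \<in> profile_maps N l r n"
      using has_vertical_profile_iff[OF n_pos lr ext] prof N by auto
    obtain h where h: "h \<in> extensional ?V" "h \<rho> = 0" "parent_tree ?V h \<rho>" and E: "E = parent_edges ?V h"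
      using tree_graph_parent_map[OF tree, of 0] unfolding MN by auto
    interpret parent_tree ?V h \<rho> by (rule h(3))
    have step: "h v \<in> step_targets S ?V a (a v)" if v: "v \<in> ?V" "v \<noteq> \<rho>" for v
    proof -
      have "child_of ?V E \<rho> (h v) v" unfolding E child_of_iff using v by simp
      then have "a v - a (h v) \<in> S" using steps inner[OF v] v MN by simp
      then show ?thesis using inner[OF v] by (simp add: step_targets_def)
    qed
    have only: "v = \<rho>" if "v \<in> ?V" "h v = 0" for v
      using inner[OF that(1)] that(2) by auto
    have unique: "\<exists>!v. v \<in> ?V \<and> h v = 0"
      using root(1) h(2) only by blast
    have the: "(THE v. v \<in> ?V \<and> h v = 0) = \<rho>"
      using root(1) h(2) only by blast
    have "h v = 0 \<and> a v = 0 \<or> h v \<in> step_targets S ?V a (a v)" if "v \<in> ?V" for v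
      using step[OF that] h(2) \<open>a \<rho> = 0\<close> by (cases "v = \<rho>") simp_all
    then have "h \<in> parent_maps S ?V a"
      using h(1) unique unfolding parent_maps_def by simp
    then have "(a, h) \<in> ?X" using a acyclic by simp
    moreover have "y = ?\<phi> (a, h)" using y MN E the by simp
    ultimately show "y \<in> ?\<phi> ` ?X" by (rule rev_image_eqI)
  qed
  ultimately show ?thesis by (auto simp: bij_betw_def)
qed

theorem theorem2p1:
  fixes S :: "int set" and l r :: int and n :: "int \<Rightarrow> nat"
  assumes max_S: "1 \<in> S" "\<forall>s\<in>S. s \<le> 1"
    and l_r: "l \<le> 0" "0 \<le> r"
    and n_pos: "\<forall>i\<in>{l..r}. 0 < n i"
    and n_outside: "\<forall>i. i < l \<or> r < i \<longrightarrow> n i = 0"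
    and min_S_or_l: "(-1 \<in> S \<and> (\<forall>s\<in>S. -1 \<le> s)) \<or> l = 0"
  shows "real (card (embedded_cayley_trees_with_profile S l r n)) =
    real (n 0) / (real (n l) * real (n r))
    * (fact (\<Sum>i\<in>{l..r}. n i) / (\<Prod>i\<in>{l..r}. fact (n i - 1)))
    * (\<Prod>i\<in>{l..r}. real (step_sum S n i) ^ (n i - 1))"
proof -
  define N where "N = (\<Sum>i\<in>{l..r}. n i)"
  let ?V = "{1..N}"
  let ?A = "profile_maps N l r n"
  let ?H = "\<lambda>a. {h\<in>parent_maps S ?V a. acyclic_map ?V h}"
  define m where "m = (\<Prod>i\<in>{l..r}. step_sum S n i ^ (n i - 1))"
  define t where "t = (\<Prod>i\<in>{l..r}. if i = 0 then 1 else n (i - sgn i))"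
  define C where "C = card (embedded_cayley_trees_with_profile S l r n)"
  have fiber: "card (?H a) = t * m" "finite (?H a)" if a: "a \<in> ?A" for a
  proof -
    have image: "a ` ?V = {l..r}" using profile_maps_image[OF a n_pos] .
    interpret inward_step_set S ?V a
    proof
      \<comment> \<open>A negative abscissa rules out \<open>l = 0\<close>, so the other alternative
        of the hypothesis holds.\<close>
      fix v assume v: "v \<in> ?V" "a v < 0"
      then have "a v \<in> {l..r}" using image by blast
      then have "l \<noteq> 0" using v by auto
      then show "-1 \<in> S \<and> (\<forall>s\<in>S. -1 \<le> s)" using min_S_or_l by blast
    qed (use max_S in auto)
    have card_level: "card (level ?V a i) = n i" for i using profile_mapsD[OF a n_outside] .
    have steps: "card (step_targets S ?V a i) = step_sum S n i" for i
      by (rule card_step_targets[OF _ card_level]) simp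
    have inward: "card (inward_targets ?V a i) = (if i = 0 then 1 else n (i - sgn i))" for i
      by (simp add: inward_targets_def card_level del: One_nat_def)
    have "card (?H a) = (\<Prod>i\<in>{l..r}. (if i = 0 then 1 else n (i - sgn i)) * step_sum S n i ^ (n i - 1))"
      using card_acyclic_parent_maps l_r unfolding image card_level steps inward by simp
    also have "\<dots> = t * m"
      unfolding t_def m_def by (rule prod.distrib)
    finally show "card (?H a) = t * m" .
    show "finite (?H a)" using finite_parent_maps by simp
  qed
  have "finite ?A" unfolding profile_maps_def by (simp add: finite_PiE)
  moreover have "C = card (SIGMA a:?A. ?H a)"
    unfolding C_def using bij_betw_same_card[OF bij_betw_embedded_trees[OF n_pos _ N_def]] l_r by simp
  ultimately have C: "C = card ?A * (t * m)" using fiber by simp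
  have A: "card ?A * (\<Prod>i\<in>{l..r}. fact (n i)) = fact N"
    using card_functions_with_level_sizes[of "{l..r}" ?V n] by (simp add: profile_maps_def N_def)
  define p where "p = (\<Prod>i\<in>{l..r}. n i)"
  define q :: nat where "q = (\<Prod>i\<in>{l..r}. fact (n i - 1))"
  have pq: "(\<Prod>i\<in>{l..r}. fact (n i)) = p * q"
    unfolding p_def q_def prod.distrib[symmetric]
    by (rule prod.cong) (use n_pos in \<open>auto simp: fact_reduce\<close>)
  have t: "t * (n l * n r) = n 0 * p"
    unfolding t_def p_def using prod_inward_shift[OF l_r] .
  \<comment> \<open>Division is postponed: the factor \<open>n l * n r\<close> turns
    \<open>t\<close> into \<open>n 0 * p\<close>, and the product of the \<open>(n i)!\<close>
    splits as \<open>p * q\<close>, so the nonzero \<open>p\<close> cancels and \<open>q\<close>,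
    made of the \<open>(n i - 1)!\<close>, remains.\<close>
  have "C * (p * q) * (n l * n r) = fact N * (t * (n l * n r)) * m"
    unfolding C A[symmetric] pq by (simp only: ac_simps)
  also have "\<dots> = n 0 * fact N * m * p" unfolding t by (simp only: ac_simps)
  finally have "p * (C * (q * (n l * n r))) = p * (n 0 * fact N * m)" by (simp only: ac_simps)
  moreover have "p \<noteq> 0" "q \<noteq> 0" using n_pos by (auto simp: p_def q_def prod_zero_iff)
  ultimately have "C * (q * (n l * n r)) = n 0 * fact N * m" by simp
  then have "real (C * (q * (n l * n r))) = real (n 0 * fact N * m)" by (rule arg_cong)
  then have "real C * (real q * (real (n l) * real (n r))) = real (n 0) * fact N * real m" by simp
  moreover have "real q \<noteq> 0" "real (n l) \<noteq> 0" "real (n r) \<noteq> 0"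
    using \<open>q \<noteq> 0\<close> n_pos l_r by auto
  ultimately have "real C = real (n 0) / (real (n l) * real (n r)) * (fact N / real q) * real m"
    by (simp add: field_simps)
  then show ?thesis by (simp add: C_def N_def q_def m_def)
qed

end
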